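(* Let $Z$ be an Ahlfors regular compact metric space of conformal dimension $Q\ge1$ and let $X$ be the hyperbolic cone over $Z$ in the sense of Bourdon–Pajot. Then $$Q\ge\inf\{p\ge1 : \Lambda^p_X(r)\lesssim r^{1-1/p}\}.$$
   Context: **Conformal dimension.** A metric space is Ahlfors $Q$-regular if it carries a measure for which balls of radius $r\in(0,\mathrm{diam})$ have measure comparable to $r^Q$; it is Ahlfors regular if this holds for some $Q$. The conformal dimension of $Z$ is the infimum of the $Q$ such that $Z$ is quasisymmetric to an Ahlfors $Q$-regular space. **Hyperbolic cone.** For a compact Ahlfors regular metric space $(Z,\rho)$ with at least two points, rescaled so that $\mathrm{diam}\,Z=1/2$, a hyperbolic cone on $Z$ is a graph $X$ with vertex set $\bigsqcup_{t\in\mathbb{N}}X_t$ (with $\mathbb{N}\ni0$), where each $X_t$ is a maximal $e^{-t}$-separated net in $Z$, and with an edge between $z\in X_t$ and $w\in X_u$ if and only if $|t-u|\le1$ and $B_Z(z,e^{-t})\cap B_Z(w,e^{-u})\ne\emptyset$. It is a Gromov hyperbolic bounded degree graph, well defined up to quasi-isometry. **Poincaré profiles.** For a finite graph $\Gamma$ with vertex set $V\Gamma$ and edge set $E\Gamma$ and $f:V\Gamma\to\mathbb{R}$ put $\nabla f(x)=\max\{|f(x)-f(y)| : xy\in E\Gamma\}$ ($0$ if $x$ has no neighbour). For $p\in[1,\infty)$ let $h^p(\Gamma)=\inf\{\|\nabla f\|_p/\|f\|_p : f:V\Gamma\to\mathbb{R},\ \sum_{v}f(v)=0,\ f\not\equiv0\}$,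 with $\ell^p$-norms for the counting measure on $V\Gamma$ (one-vertex graphs are given $h^p=0$). For a bounded degree graph $X$, $\Lambda^p_X(r)=\sup\{|V\Gamma|\,h^p(\Gamma) : \Gamma\le X \text{ a finite subgraph},\ |V\Gamma|\le r\}$. For functions, $f\lesssim g$ means there is a constant $C$ with $f(r)\le Cg(Cr+C)+C$ for all $r$. *)

theory Defs
  imports "HOL-Analysis.Analysis" "Graph_Theory.Digraph_Component"
begin

section \<open>Metric spaces and conformal dimension\<close>

text \<open>The diameter is extended-valued, as Ahlfors regular spaces may be unbounded.\<close>

definition mdiam :: "'a metric \<Rightarrow> ennreal" where
  "mdiam Z = (SUP x\<in>mspace Z. SUP y\<in>mspace Z. ennreal (mdist Z x y))"

definition mscale :: "real \<Rightarrow> 'a metric \<Rightarrow> 'a metric" where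
  "mscale c Z = metric (mspace Z, \<lambda>x y. c * mdist Z x y)"

lemma Metric_space_scale:
  assumes "c > 0"
  shows "Metric_space (mspace Z) (\<lambda>x y. c * mdist Z x y)"
proof
  interpret Metric_space "mspace Z" "mdist Z" by simp
  show "0 \<le> c * mdist Z x y" "c * mdist Z x y = c * mdist Z y x" for x y
    using assms by (simp_all add: commute)
  show "c * mdist Z x y = 0 \<longleftrightarrow> x = y" if "x \<in> mspace Z" "y \<in> mspace Z" for x y
    using assms that by simp
  show "c * mdist Z x z \<le> c * mdist Z x y + c * mdist Z y z"
    if "x \<in> mspace Z" "y \<in> mspace Z" "z \<in> mspace Z" for x y z
    using assms triangle[OF that] by (simp flip: distrib_left)
qed

lemma mscale_simps [simp]:
  assumes "c > 0"
  shows "mspace (mscale c Z) = mspace Z" "mdist (mscale c Z) x y = c * mdist Z x y"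
  unfolding mscale_def
  by (simp_all only: Metric_space.mspace_metric[OF Metric_space_scale[OF assms]]
      Metric_space.mdist_metric[OF Metric_space_scale[OF assms]])

text \<open>The condition \<open>0 \<le> Q\<close> only matters for spaces with at most one point, where the
  range of radii is empty.\<close>

definition Ahlfors_regular :: "real \<Rightarrow> 'a metric \<Rightarrow> bool" where
  "Ahlfors_regular Q Z \<longleftrightarrow> 0 \<le> Q \<and>
     (\<exists>\<mu>. space \<mu> = mspace Z
        \<and> sets \<mu> = sigma_sets (mspace Z) {U. openin (mtopology_of Z) U}
        \<and> (\<exists>C>0. \<forall>x\<in>mspace Z. \<forall>r>0. ennreal r < mdiam Z \<longrightarrow>
              ennreal (r powr Q / C) \<le> emeasure \<mu> (mball_of Z x r) \<and>
              emeasure \<mu> (mball_of Z x r) \<le> ennreal (C * r powr Q)))"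

definition quasisymmetry :: "'a metric \<Rightarrow> 'b metric \<Rightarrow> ('a \<Rightarrow> 'b) \<Rightarrow> bool" where
  "quasisymmetry Z W f \<longleftrightarrow>
     homeomorphic_map (mtopology_of Z) (mtopology_of W) f \<and>
     (\<exists>\<eta> :: real \<Rightarrow> real.
        homeomorphic_map (top_of_set {0..}) (top_of_set {0..}) \<eta> \<and>
        (\<forall>x\<in>mspace Z. \<forall>y\<in>mspace Z. \<forall>z\<in>mspace Z. x \<noteq> z \<longrightarrow>
           mdist W (f x) (f y) / mdist W (f x) (f z) \<le> \<eta> (mdist Z x y / mdist Z x z)))"

definition quasisymmetric :: "'a metric \<Rightarrow> 'b metric \<Rightarrow> bool" where
  "quasisymmetric Z W \<longleftrightarrow> (\<exists>f. quasisymmetry Z W f)"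

text \<open>Letting \<open>W\<close> range over metric spaces whose points are taken from the same type as those
  of \<open>Z\<close> is no restriction: a quasisymmetry is a bijection, so any metric space quasisymmetric
  to \<open>Z\<close> is isometric to one with the same points as \<open>Z\<close>.\<close>

definition conformal_dimension :: "'a metric \<Rightarrow> ereal" where
  "conformal_dimension Z =
     Inf {ereal Q | Q. \<exists>W :: 'a metric. quasisymmetric Z W \<and> Ahlfors_regular Q W}"


section \<open>Hyperbolic cones\<close>

definition separated_in :: "'a metric \<Rightarrow> real \<Rightarrow> 'a set \<Rightarrow> bool" where
  "separated_in Z \<epsilon> N \<longleftrightarrow>
     N \<subseteq> mspace Z \<and> (\<forall>x\<in>N. \<forall>y\<in>N. x \<noteq> y \<longrightarrow> \<epsilon> \<le> mdist Z x y)"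

definition maximal_separated_net :: "'a metric \<Rightarrow> real \<Rightarrow> 'a set \<Rightarrow> bool" where
  "maximal_separated_net Z \<epsilon> N \<longleftrightarrow>
     separated_in Z \<epsilon> N \<and> (\<forall>N'. separated_in Z \<epsilon> N' \<and> N \<subseteq> N' \<longrightarrow> N' = N)"

text \<open>Graphs are simple undirected graphs, represented as loop-free symmetric digraphs. The
  vertex \<open>(t, z)\<close> is the point \<open>z\<close> of the net \<open>N t\<close>.\<close>

definition cone_graph :: "'a metric \<Rightarrow> (nat \<Rightarrow> 'a set) \<Rightarrow> (nat \<times> 'a) pair_pre_digraph" where
  "cone_graph Z N =
     \<lparr> pverts = (SIGMA t:UNIV. N t),
       parcs = {((t, z), (u, w)) | t z u w.
          z \<in> N t \<and> w \<in> N u \<and> (t, z) \<noteq> (u, w) \<and> \<bar>int t - int u\<bar> \<le> 1 \<and>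
          mball_of Z z (exp (- real t)) \<inter> mball_of Z w (exp (- real u)) \<noteq> {}} \<rparr>"

definition hyperbolic_cone :: "'a metric \<Rightarrow> (nat \<times> 'a) pair_pre_digraph \<Rightarrow> bool" where
  "hyperbolic_cone Z X \<longleftrightarrow>
     (\<exists>c>0. mdiam (mscale c Z) = ennreal (1/2) \<and>
        (\<exists>N. (\<forall>t. maximal_separated_net (mscale c Z) (exp (- real t)) (N t)) \<and>
             X = cone_graph (mscale c Z) N))"


section \<open>Poincare profiles\<close>

definition graph_gradient :: "'v pair_pre_digraph \<Rightarrow> ('v \<Rightarrow> real) \<Rightarrow> 'v \<Rightarrow> real" where
  "graph_gradient \<Gamma> f x =
     (if \<exists>y. (x, y) \<in> parcs \<Gamma> then Max {\<bar>f x - f y\<bar> | y. (x, y) \<in> parcs \<Gamma>} else 0)"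

definition lp_norm_on :: "real \<Rightarrow> 'v set \<Rightarrow> ('v \<Rightarrow> real) \<Rightarrow> real" where
  "lp_norm_on p V f = (\<Sum>v\<in>V. \<bar>f v\<bar> powr p) powr (1 / p)"

text \<open>With at most one vertex there is no admissible function, and the constant is \<open>0\<close> by
  convention.\<close>

definition poincare_constant :: "real \<Rightarrow> 'v pair_pre_digraph \<Rightarrow> real" where
  "poincare_constant p \<Gamma> =
     (if card (pverts \<Gamma>) \<le> 1 then 0
      else Inf {lp_norm_on p (pverts \<Gamma>) (graph_gradient \<Gamma> f) / lp_norm_on p (pverts \<Gamma>) f | f.
                  (\<Sum>v\<in>pverts \<Gamma>. f v) = 0 \<and> (\<exists>v\<in>pverts \<Gamma>. f v \<noteq> 0)})"

text \<open>The locale predicate \<open>pair_graph\<close> says that the graph is finite (and simple).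
  For \<open>r \<ge> 0\<close> the set below is nonempty (it contains the empty graph) and bounded above.\<close>

definition poincare_profile :: "'v pair_pre_digraph \<Rightarrow> real \<Rightarrow> real \<Rightarrow> real" where
  "poincare_profile X p r =
     Sup {real (card (pverts \<Gamma>)) * poincare_constant p \<Gamma> | \<Gamma>.
            pair_graph \<Gamma> \<and> subgraph (with_proj \<Gamma>) (with_proj X) \<and> real (card (pverts \<Gamma>)) \<le> r}"

text \<open>Functions are compared on the half-line of nonnegative reals.\<close>

definition coarsely_le :: "(real \<Rightarrow> real) \<Rightarrow> (real \<Rightarrow> real) \<Rightarrow> bool" where
  "coarsely_le f g \<longleftrightarrow> (\<exists>C>0. \<forall>r\<ge>0. f r \<le> C * g (C * r + C) + C)"

end

theory Submission
  imports Defs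
begin

text \<open>Given \<open>p > Q\<close>, choose \<open>W\<close> quasisymmetric to \<open>Z\<close> and Ahlfors \<open>Q'\<close>-regular with \<open>Q' < p\<close>, and
  measure each cell of the cone by its width in the metric \<open>\<rho>\<close> of \<open>W\<close>. A cone vertex lies within reach
  \<open>s\<close> of \<open>z\<close> if \<open>\<rho>\<close>-distance to \<open>z\<close> plus width is at most \<open>s\<close>. The bump function that is 1 within
  reach \<open>s\<close> and vanishes beyond reach \<open>2s\<close> has gradient at most a multiple of width over \<open>s\<close>; since
  widths decay geometrically along cells over a point and \<open>\<rho>\<close>-disjoint cells obey a \<open>Q'\<close>-dimensional
  packing bound, its \<open>p\<close>-energy is bounded independently of \<open>z\<close> and \<open>s\<close>. In any large finite subgraph a
  pigeonhole argument over scales finds \<open>z\<close> and \<open>s\<close> for which the bump is 1 on a fixed proportion of the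
  \<open>n\<close> vertices and 0 on at least half of them, so that \<open>h\<^sup>p\<close> is at most a multiple of \<open>n\<close> to the
  power \<open>-1/p\<close>.\<close>

section \<open>Upper bounds on Poincare constants\<close>

lemma lp_norm_on_nonneg: "0 \<le> lp_norm_on p V f"
  by (simp add: lp_norm_on_def)

lemma
  assumes "finite (parcs \<Gamma>)"
  shows graph_gradient_nonneg: "0 \<le> graph_gradient \<Gamma> f x"
    and graph_gradient_le: "0 \<le> b \<Longrightarrow> (\<And>y. (x, y) \<in> parcs \<Gamma> \<Longrightarrow> \<bar>f x - f y\<bar> \<le> b) \<Longrightarrow> graph_gradient \<Gamma> f x \<le> b"
proof -
  let ?A = "{\<bar>f x - f y\<bar> | y. (x, y) \<in> parcs \<Gamma>}"
  have "?A = (\<lambda>y. \<bar>f x - f y\<bar>) ` (snd ` (parcs \<Gamma> \<inter> {x} \<times> UNIV))"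
    by force
  then have fin: "finite ?A"
    using assms by simp
  show "0 \<le> graph_gradient \<Gamma> f x"
  proof (cases "\<exists>y. (x, y) \<in> parcs \<Gamma>")
    case True
    then obtain y where "(x, y) \<in> parcs \<Gamma>" ..
    then have "\<bar>f x - f y\<bar> \<le> Max ?A"
      using fin by (intro Max_ge) auto
    then show ?thesis
      using True abs_ge_zero[of "f x - f y"] unfolding graph_gradient_def by (simp only: if_True)
  qed (simp add: graph_gradient_def)
  show "graph_gradient \<Gamma> f x \<le> b" if "0 \<le> b" "\<And>y. (x, y) \<in> parcs \<Gamma> \<Longrightarrow> \<bar>f x - f y\<bar> \<le> b"
    using that fin by (auto simp: graph_gradient_def)
qed

lemma poincare_constant_le:
  assumes "(\<Sum>v\<in>pverts \<Gamma>. f v) = 0" "\<exists>v\<in>pverts \<Gamma>. f v \<noteq> 0"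
  shows "poincare_constant p \<Gamma> \<le>
    lp_norm_on p (pverts \<Gamma>) (graph_gradient \<Gamma> f) / lp_norm_on p (pverts \<Gamma>) f"
proof -
  have "Inf {lp_norm_on p (pverts \<Gamma>) (graph_gradient \<Gamma> f) / lp_norm_on p (pverts \<Gamma>) f | f.
          (\<Sum>v\<in>pverts \<Gamma>. f v) = 0 \<and> (\<exists>v\<in>pverts \<Gamma>. f v \<noteq> 0)} \<le>
        lp_norm_on p (pverts \<Gamma>) (graph_gradient \<Gamma> f) / lp_norm_on p (pverts \<Gamma>) f"
    using assms by (intro cInf_lower bdd_belowI[of _ 0]) (auto simp: lp_norm_on_nonneg)
  \<comment> \<open>With at most one vertex the constant is 0 by convention, and the quotient is
    nonnegative.\<close>
  then show ?thesis
    by (simp add: poincare_constant_def lp_norm_on_nonneg)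
qed

text \<open>Subtracting the mean \<open>m\<close> makes \<open>F\<close> admissible without changing
  its gradient. The values 0 and 1 are 1 apart, so one of them is at distance at least 1/2 from
  \<open>m\<close>; its level set alone, with at least \<open>\<theta>\<close> vertices, keeps the
  p-norm above \<open>\<theta> powr (1/p) / 2\<close>.\<close>

lemma poincare_constant_le_bump:
  assumes \<Gamma>: "finite (pverts \<Gamma>)" "finite (parcs \<Gamma>)" and p: "p \<ge> 1"
    and \<theta>: "0 < \<theta>" "\<theta> \<le> real (card {v \<in> pverts \<Gamma>. F v = 1})"
      "\<theta> \<le> real (card {v \<in> pverts \<Gamma>. F v = 0})"
    and E: "(\<Sum>v\<in>pverts \<Gamma>. graph_gradient \<Gamma> F v powr p) \<le> E"
  shows "poincare_constant p \<Gamma> \<le> 2 * (E / \<theta>) powr (1 / p)"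
proof -
  let ?V = "pverts \<Gamma>"
  define m where "m = (\<Sum>v\<in>?V. F v) / real (card ?V)"
  define f where "f v = F v - m" for v
  have "{v \<in> ?V. F v = 1} \<noteq> {}"
    using \<theta> by (metis card.empty less_le_not_le of_nat_0)
  then have "?V \<noteq> {}"
    by blast
  have f0: "(\<Sum>v\<in>?V. f v) = 0"
    using \<open>?V \<noteq> {}\<close> \<Gamma> by (simp add: f_def m_def sum_subtractf)
  have "\<exists>c. \<bar>c - m\<bar> \<ge> 1/2 \<and> \<theta> \<le> real (card {v \<in> ?V. F v = c})"
  proof (cases "m \<ge> 1/2")
    case True
    then show ?thesis
      using \<theta> by (intro exI[of _ 0]) auto
  next
    case False
    then show ?thesis
      using \<theta> by (intro exI[of _ 1]) auto
  qed
  then obtain c where c: "\<bar>c - m\<bar> \<ge> 1/2" "\<theta> \<le> real (card {v \<in> ?V. F v = c})"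
    by blast
  have "{v \<in> ?V. F v = c} \<noteq> {}"
    using \<theta>(1) c by (metis card.empty less_le_not_le of_nat_0)
  then have f1: "\<exists>v\<in>?V. f v \<noteq> 0"
    using c(1) by (force simp: f_def)
  have "\<theta> * (1/2) powr p \<le> real (card {v \<in> ?V. F v = c}) * (1/2) powr p"
    using c by (intro mult_right_mono) auto
  also have "\<dots> = (\<Sum>v\<in>{v \<in> ?V. F v = c}. (1/2) powr p)"
    by simp
  also have "\<dots> \<le> (\<Sum>v\<in>{v \<in> ?V. F v = c}. \<bar>f v\<bar> powr p)"
    using c(1) p by (intro sum_mono powr_mono2) (auto simp: f_def)
  also have "\<dots> \<le> (\<Sum>v\<in>?V. \<bar>f v\<bar> powr p)"
    using \<Gamma> by (intro sum_mono2) auto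
  finally have "(\<theta> * (1/2) powr p) powr (1/p) \<le> lp_norm_on p ?V f"
    unfolding lp_norm_on_def using p \<theta>(1) by (intro powr_mono2) auto
  moreover have "(\<theta> * (1/2) powr p) powr (1/p) = \<theta> powr (1/p) / 2"
    using p \<theta>(1) by (simp add: powr_mult powr_powr)
  ultimately have lower: "\<theta> powr (1/p) / 2 \<le> lp_norm_on p ?V f"
    by simp
  have grad: "graph_gradient \<Gamma> f = graph_gradient \<Gamma> F"
    by (simp add: graph_gradient_def f_def fun_eq_iff)
  have "lp_norm_on p ?V (graph_gradient \<Gamma> f) \<le> E powr (1/p)"
    unfolding lp_norm_on_def grad using E p graph_gradient_nonneg[OF \<Gamma>(2)] by (intro powr_mono2) (auto intro: sum_nonneg)
  then have "lp_norm_on p ?V (graph_gradient \<Gamma> f) / lp_norm_on p ?V f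
      \<le> E powr (1/p) / (\<theta> powr (1/p) / 2)"
    using lower \<theta>(1) by (intro frac_le) auto
  also have "\<dots> = 2 * (E / \<theta>) powr (1/p)"
  proof -
    have "0 \<le> E"
      using E by (rule order_trans[rotated]) (auto intro: sum_nonneg)
    then show ?thesis
      using \<theta>(1) by (simp add: powr_divide)
  qed
  finally show ?thesis
    using poincare_constant_le[OF f0 f1, of p] by simp
qed

text \<open>A crude bound for subgraphs too small for the concentration argument. The indicator of
  one vertex has gradient at most 1, so its energy is at most the number of vertices;
  \<open>a\<close> and \<open>b\<close> supply the two level sets with \<open>\<theta>\<close> equal
  to 1.\<close>

lemma poincare_constant_le_card:
  assumes \<Gamma>: "finite (pverts \<Gamma>)" "finite (parcs \<Gamma>)" and p: "p \<ge> 1"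
  shows "poincare_constant p \<Gamma> \<le> 2 * real (card (pverts \<Gamma>))"
proof (cases "card (pverts \<Gamma>) \<le> 1")
  case False
  let ?V = "pverts \<Gamma>"
  from False obtain a b where ab: "a \<in> ?V" "b \<in> ?V" "a \<noteq> b"
    by (metis card_le_Suc0_iff_eq \<Gamma>(1) One_nat_def)
  define F :: "_ \<Rightarrow> real" where "F v = (if v = a then 1 else 0)" for v
  have grad: "0 \<le> graph_gradient \<Gamma> F v \<and> graph_gradient \<Gamma> F v \<le> 1" for v
    using \<Gamma>(2) by (auto simp: F_def intro!: graph_gradient_nonneg graph_gradient_le)
  have "(\<Sum>v\<in>?V. graph_gradient \<Gamma> F v powr p) \<le> (\<Sum>v\<in>?V. 1)"
    using grad p by (intro sum_mono powr_le1) auto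
  moreover have "card {a} \<le> card {v \<in> ?V. F v = 1}"
    using ab \<Gamma> by (intro card_mono) (auto simp: F_def)
  moreover have "card {b} \<le> card {v \<in> ?V. F v = 0}"
    using ab \<Gamma> by (intro card_mono) (auto simp: F_def)
  ultimately have "poincare_constant p \<Gamma> \<le> 2 * (real (card ?V) / 1) powr (1/p)"
    using \<Gamma> p by (intro poincare_constant_le_bump) auto
  also have "\<dots> \<le> 2 * real (card ?V) powr 1"
    unfolding div_by_1 using False p by (intro mult_left_mono powr_mono) auto
  finally show ?thesis
    using False by simp
qed (simp add: poincare_constant_def)

text \<open>Reduction to large subgraphs: multiplying the bound \<open>large\<close> by the number n
  of vertices gives C times n to the power 1 - 1/p, while subgraphs below the threshold
  \<open>M\<close> contribute a bounded amount, absorbed by the additive constant.\<close>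

lemma coarsely_le_poincare_profile:
  assumes p: "p \<ge> 1" and "C > 0"
    and large: "\<And>\<Gamma>. pair_graph \<Gamma> \<Longrightarrow> subgraph (with_proj \<Gamma>) (with_proj X) \<Longrightarrow> M \<le> real (card (pverts \<Gamma>))
        \<Longrightarrow> 1 \<le> card (pverts \<Gamma>) \<Longrightarrow> poincare_constant p \<Gamma> \<le> C * real (card (pverts \<Gamma>)) powr (- 1 / p)"
  shows "coarsely_le (poincare_profile X p) (\<lambda>r. r powr (1 - 1 / p))"
proof -
  \<comment> \<open>\<open>C\<close> serves large subgraphs and \<open>2 * M\<^sup>2\<close> small
    ones. When no subgraph is admissible, as for negative \<open>r\<close>, the profile is the
    unspecified real \<open>Sup {}\<close>, which is covered by its own summand.\<close>
  define B where "B = C + 2 * M\<^sup>2 + \<bar>Sup {} :: real\<bar> + 1"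
  have "B > 0" "C \<le> B" "1 \<le> B"
    using \<open>C > 0\<close> by (auto simp: B_def add_pos_nonneg)
  have main: "real (card (pverts \<Gamma>)) * poincare_constant p \<Gamma> \<le> B * (B * r + B) powr (1 - 1 / p) + B"
    if \<Gamma>: "pair_graph \<Gamma>" "subgraph (with_proj \<Gamma>) (with_proj X)" "real (card (pverts \<Gamma>)) \<le> r" for \<Gamma> r
  proof -
    interpret pair_graph \<Gamma> by fact
    let ?n = "real (card (pverts \<Gamma>))"
    consider "?n < M" | "card (pverts \<Gamma>) = 0" | "M \<le> ?n" "1 \<le> card (pverts \<Gamma>)"
      by linarith
    then show ?thesis
    proof cases
      case 1
      have "?n * poincare_constant p \<Gamma> \<le> ?n * (2 * ?n)"
        using p by (intro mult_left_mono poincare_constant_le_card) auto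
      also have "\<dots> \<le> 2 * M\<^sup>2"
        using 1 by (simp add: power2_eq_square mult_mono)
      also have "\<dots> \<le> B"
        using \<open>C > 0\<close> by (simp add: B_def)
      finally show ?thesis
        using \<open>B > 0\<close> by (smt (verit) mult_nonneg_nonneg powr_ge_zero)
    next
      case 2
      then show ?thesis using \<open>B > 0\<close> by simp
    next
      case 3
      have "?n * poincare_constant p \<Gamma> \<le> ?n * (C * ?n powr (- 1 / p))"
        using large[OF \<Gamma>(1,2) 3] by (intro mult_left_mono) auto
      also have "\<dots> = C * (?n powr 1 * ?n powr (- 1 / p))"
        using 3 by simp
      also have "\<dots> = C * ?n powr (1 - 1 / p)"
        unfolding powr_add[symmetric] by simp
      also have "\<dots> \<le> B * (B * r + B) powr (1 - 1 / p)"
      proof -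
        have "?n \<le> r" using \<Gamma> by simp
        moreover have "0 \<le> r" using \<open>?n \<le> r\<close> by (rule order_trans[rotated]) simp
        then have "1 * r \<le> B * r"
          using \<open>1 \<le> B\<close> by (intro mult_right_mono) auto
        ultimately have "?n \<le> B * r + B"
          using \<open>B > 0\<close> by linarith
        then show ?thesis
          using p \<open>C \<le> B\<close> \<open>B > 0\<close> by (intro mult_mono powr_mono2) auto
      qed
      finally show ?thesis using \<open>B > 0\<close> by linarith
    qed
  qed
  have "poincare_profile X p r \<le> B * (B * r + B) powr (1 - 1 / p) + B" for r
  proof (cases "{real (card (pverts \<Gamma>)) * poincare_constant p \<Gamma> | \<Gamma>. pair_graph \<Gamma> \<and>
      subgraph (with_proj \<Gamma>) (with_proj X) \<and> real (card (pverts \<Gamma>)) \<le> r} = {}")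
    case True
    have "Sup {} \<le> B"
      using \<open>C > 0\<close> unfolding B_def by (smt (verit) zero_le_power2)
    then have "Sup {} \<le> B * (B * r + B) powr (1 - 1 / p) + B"
      using \<open>B > 0\<close> by (smt (verit) mult_nonneg_nonneg powr_ge_zero)
    then show ?thesis
      unfolding poincare_profile_def True .
  next
    case False
    then show ?thesis
      unfolding poincare_profile_def using main by (intro cSup_least) auto
  qed
  then show ?thesis
    unfolding coarsely_le_def using \<open>B > 0\<close> by blast
qed


section \<open>Bump functions on a hyperbolic filling\<close>

text \<open>The setting after pulling the metric of \<open>W\<close> back to the points of
  \<open>Z\<close>: \<open>d\<close> is the metric of the cone, \<open>\<rho>\<close> the regular
  one. \<open>perfect\<close> is uniform perfectness, \<open>qs_bounded\<close> and
  \<open>qs_small\<close> express quasisymmetry without division, and \<open>packing\<close> is the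
  trace of Ahlfors regularity. Its balls are indexed by cells, so that radii may depend on the
  level, and the bound \<open>D / 2\<close> keeps the radii where the lower measure bound is
  available.\<close>

locale hyperbolic_filling = Z: Metric_space S d + W: Metric_space S \<rho>
  for S :: "'a set" and d \<rho> :: "'a \<Rightarrow> 'a \<Rightarrow> real" +
  fixes \<kappa> Q D K :: real and N :: "nat \<Rightarrow> 'a set"
  assumes \<kappa>: "0 < \<kappa>" and Q: "0 \<le> Q"
    and perfect: "\<And>x r. x \<in> S \<Longrightarrow> 0 < r \<Longrightarrow> r \<le> 1 \<Longrightarrow> \<exists>y\<in>S. \<kappa> * r \<le> d x y \<and> d x y \<le> r"
    and qs_bounded: "\<And>a. \<exists>H\<ge>1. \<forall>x\<in>S. \<forall>y\<in>S. \<forall>z\<in>S. d x y \<le> a * d x z \<longrightarrow> \<rho> x y \<le> H * \<rho> x z"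
    and qs_small: "\<And>\<epsilon>. 0 < \<epsilon> \<Longrightarrow> \<exists>l>0. \<forall>x\<in>S. \<forall>y\<in>S. \<forall>z\<in>S. d x y \<le> l * d x z \<longrightarrow> \<rho> x y \<le> \<epsilon> * \<rho> x z"
    and D: "0 < D" "\<And>x y. x \<in> S \<Longrightarrow> y \<in> S \<Longrightarrow> \<rho> x y \<le> D"
    and K: "0 < K"
    and packing: "\<And>(I :: (nat \<times> _) set) r z R. finite I \<Longrightarrow> z \<in> S \<Longrightarrow> 0 \<le> R \<Longrightarrow>
        (\<And>v. v \<in> I \<Longrightarrow> snd v \<in> S \<and> 0 < r v \<and> r v \<le> D / 2 \<and> \<rho> z (snd v) + r v \<le> R) \<Longrightarrow>
        pairwise (\<lambda>v v'. W.mball (snd v) (r v) \<inter> W.mball (snd v') (r v') = {}) I \<Longrightarrow>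
        (\<Sum>v\<in>I. r v powr Q) \<le> K * R powr Q"
    and net: "\<And>t. N t \<subseteq> S" "\<And>t x y. x \<in> N t \<Longrightarrow> y \<in> N t \<Longrightarrow> x \<noteq> y \<Longrightarrow> exp (- real t) \<le> d x y"
begin

section \<open>Cells of the filling and their widths\<close>

definition vertices :: "(nat \<times> 'a) set" where
  "vertices = (SIGMA t:UNIV. N t)"

definition mate :: "nat \<times> 'a \<Rightarrow> 'a" where
  "mate v = (SOME y. y \<in> S \<and> \<kappa> * exp (- real (fst v)) \<le> d (snd v) y \<and> d (snd v) y \<le> exp (- real (fst v)))"

text \<open>A substitute for the \<open>\<rho>\<close>-size of the cell. As the mate lies at
  \<open>d\<close>-distance comparable to the radius of the cell, quasisymmetry compares every other
  \<open>\<rho>\<close>-distance at that scale with this one.\<close>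

definition width :: "nat \<times> 'a \<Rightarrow> real" where
  "width v = \<rho> (snd v) (mate v)"

lemma vertices_in [simp]: "v \<in> vertices \<Longrightarrow> snd v \<in> S"
  using net(1) by (force simp: vertices_def)

lemma mate:
  assumes "v \<in> vertices"
  shows "mate v \<in> S" "\<kappa> * exp (- real (fst v)) \<le> d (snd v) (mate v)" "d (snd v) (mate v) \<le> exp (- real (fst v))"
proof -
  have "\<exists>y. y \<in> S \<and> \<kappa> * exp (- real (fst v)) \<le> d (snd v) y \<and> d (snd v) y \<le> exp (- real (fst v))"
    using perfect[OF vertices_in[OF assms], of "exp (- real (fst v))"] by auto
  from someI_ex[OF this] show "mate v \<in> S" "\<kappa> * exp (- real (fst v)) \<le> d (snd v) (mate v)"
      "d (snd v) (mate v) \<le> exp (- real (fst v))"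
    unfolding mate_def by auto
qed

lemma width_pos: "v \<in> vertices \<Longrightarrow> 0 < width v"
  and width_le_D: "v \<in> vertices \<Longrightarrow> width v \<le> D"
proof -
  assume v: "v \<in> vertices"
  have "0 < \<kappa> * exp (- real (fst v))" using \<kappa> by simp
  then have "d (snd v) (mate v) \<noteq> 0"
    using mate(2)[OF v] by linarith
  then have "\<rho> (snd v) (mate v) \<noteq> 0"
    using v mate(1)[OF v] by simp
  then show "0 < width v"
    using W.nonneg[of "snd v" "mate v"] unfolding width_def by linarith
  show "width v \<le> D"
    using v D mate(1)[OF v] by (simp add: width_def)
qed

text \<open>The mate is at \<open>d\<close>-distance at least \<open>\<kappa>\<close> times the
  scale of the cell, so the ratio of the \<open>d\<close>-distances of \<open>x\<close> and of the
  mate is at most a/\<open>\<kappa>\<close>, and \<open>qs_bounded\<close> at this ratio supplies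
  \<open>H\<close>.\<close>

lemma dist_le_width:
  obtains H where "H \<ge> 1"
    "\<And>v x. v \<in> vertices \<Longrightarrow> x \<in> S \<Longrightarrow> d (snd v) x \<le> a * exp (- real (fst v)) \<Longrightarrow> \<rho> (snd v) x \<le> H * width v"
proof -
  \<comment> \<open>The maximum with 0 keeps the ratio nonnegative, as monotonicity of
    multiplication requires, whatever the sign of \<open>a\<close>.\<close>
  obtain H where H: "H \<ge> 1"
    "\<And>x y z. x \<in> S \<Longrightarrow> y \<in> S \<Longrightarrow> z \<in> S \<Longrightarrow> d x y \<le> (max a 0 / \<kappa>) * d x z \<Longrightarrow> \<rho> x y \<le> H * \<rho> x z"
    using qs_bounded[of "max a 0 / \<kappa>"] by blast
  show ?thesis
  proof (rule that[OF H(1)])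
    fix v x assume v: "v \<in> vertices" "x \<in> S" "d (snd v) x \<le> a * exp (- real (fst v))"
    have "d (snd v) x \<le> max a 0 * exp (- real (fst v))"
      using v(3) by (smt (verit) exp_gt_zero mult_right_mono)
    also have "\<dots> = (max a 0 / \<kappa>) * (\<kappa> * exp (- real (fst v)))"
      using \<kappa> by simp
    also have "\<dots> \<le> (max a 0 / \<kappa>) * d (snd v) (mate v)"
      using mate(2)[OF v(1)] \<kappa> by (intro mult_left_mono) auto
    finally show "\<rho> (snd v) x \<le> H * width v"
      unfolding width_def using v mate(1) by (intro H(2)) auto
  qed
qed

text \<open>A converse to \<open>dist_le_width\<close>: the mate is at most twice as far from the
  centre as a point at half the scale or more, so quasisymmetry at ratio 2 keeps such a point at
  \<open>\<rho>\<close>-distance at least width/H. Half the scale is what makes these balls disjoint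
  for distinct net points of one level.\<close>

lemma width_ball:
  obtains c where "0 < c" "c \<le> 1/2"
    "\<And>v x. v \<in> vertices \<Longrightarrow> x \<in> W.mball (snd v) (c * width v) \<Longrightarrow> d (snd v) x < exp (- real (fst v)) / 2"
proof -
  obtain H where H: "H \<ge> 1"
    "\<And>x y z. x \<in> S \<Longrightarrow> y \<in> S \<Longrightarrow> z \<in> S \<Longrightarrow> d x y \<le> 2 * d x z \<Longrightarrow> \<rho> x y \<le> H * \<rho> x z"
    using qs_bounded[of 2] by blast
  show ?thesis
  proof (rule that[of "1 / (2 * H)"])
    show "0 < 1 / (2 * H)" "1 / (2 * H) \<le> 1/2"
      using H(1) by (auto simp: field_simps)
    fix v x assume v: "v \<in> vertices" "x \<in> W.mball (snd v) (1 / (2 * H) * width v)"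
    show "d (snd v) x < exp (- real (fst v)) / 2"
    proof (rule ccontr)
      assume "\<not> ?thesis"
      then have "d (snd v) (mate v) \<le> 2 * d (snd v) x"
        using mate(3)[OF v(1)] by linarith
      then have "width v \<le> H * \<rho> (snd v) x"
        unfolding width_def using v mate(1) by (intro H(2)) auto
      also have "\<dots> < H * (1 / (2 * H) * width v)"
        using v H(1) by (intro mult_strict_left_mono) auto
      also have "\<dots> = width v / 2"
        using H(1) by simp
      finally show False
        using width_pos[OF v(1)] by simp
    qed
  qed
qed

text \<open>Widths decay geometrically along the cells containing a common point: compare both cells with
  whichever of the centre and the mate of the larger cell is far from the centre of the smaller one.\<close>

lemma width_decay:
  obtains m :: nat where "m \<ge> 1"
    "\<And>v v' x. v \<in> vertices \<Longrightarrow> v' \<in> vertices \<Longrightarrow> x \<in> S \<Longrightarrow> fst v + m \<le> fst v' \<Longrightarrow>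
      d (snd v) x < exp (- real (fst v)) / 2 \<Longrightarrow> d (snd v') x < exp (- real (fst v')) / 2 \<Longrightarrow> 2 * width v' \<le> width v"
proof -
  obtain H where H: "H \<ge> 1"
    "\<And>v x. v \<in> vertices \<Longrightarrow> x \<in> S \<Longrightarrow> d (snd v) x \<le> 1 * exp (- real (fst v)) \<Longrightarrow> \<rho> (snd v) x \<le> H * width v"
    using dist_le_width[of 1] by blast
  \<comment> \<open>\<open>\<epsilon> * (H + 1)\<close> is 1/2, and \<open>H + 1\<close> will bound
    the \<open>\<rho>\<close>-distance from the small centre to the comparison point in units of the
    larger width.\<close>
  define \<epsilon> where "\<epsilon> = 1 / (2 * (H + 1))"
  have "\<epsilon> > 0" using H(1) by (simp add: \<epsilon>_def)
  then obtain l where l: "l > 0"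
    "\<And>x y z. x \<in> S \<Longrightarrow> y \<in> S \<Longrightarrow> z \<in> S \<Longrightarrow> d x y \<le> l * d x z \<Longrightarrow> \<rho> x y \<le> \<epsilon> * \<rho> x z"
    using qs_small[of \<epsilon>] by blast
  obtain m0 :: nat where m0: "2 / (l * \<kappa>) \<le> real m0"
    using real_arch_simple by blast
  \<comment> \<open>Descending \<open>m\<close> levels shrinks the scale by the factor
    \<open>l * \<kappa> / 2\<close>, because the exponential of \<open>m\<close> exceeds
    \<open>m\<close>.\<close>
  define m where "m = Suc m0"
  have "2 / (l * \<kappa>) \<le> exp (real m)"
    using m0 exp_ge_add_one_self[of "real m"] by (simp add: m_def)
  then have em: "exp (- real m) \<le> l * \<kappa> / 2"
    using l(1) \<kappa> by (simp add: exp_minus field_simps)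
  show ?thesis
  proof (rule that[of m])
    show "m \<ge> 1" by (simp add: m_def)
    fix v v' x
    assume v: "v \<in> vertices" "v' \<in> vertices" "x \<in> S" "fst v + m \<le> fst v'"
      "d (snd v) x < exp (- real (fst v)) / 2" "d (snd v') x < exp (- real (fst v')) / 2"
    let ?w = "snd v" and ?w' = "snd v'" and ?y = "mate v" and ?y' = "mate v'"
    note in_S = vertices_in[OF v(1)] vertices_in[OF v(2)] mate(1)[OF v(1)] mate(1)[OF v(2)]
    have le: "exp (- real (fst v')) \<le> exp (- real m) * exp (- real (fst v))"
      using v(4) by (simp add: exp_add[symmetric] flip: of_nat_add)
    also have "\<dots> \<le> 1 * exp (- real (fst v))"
      by (intro mult_right_mono) auto
    finally have "exp (- real (fst v')) \<le> exp (- real (fst v))"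
      by simp
    then have "d ?w ?w' \<le> 1 * exp (- real (fst v))"
      using v(5,6) Z.triangle[OF in_S(1) v(3) in_S(2)] Z.commute[of x ?w'] by linarith
    then have ww': "\<rho> ?w ?w' \<le> H * width v"
      using v by (intro H(2)) auto
    \<comment> \<open>The centre and the mate of \<open>v\<close> are at least
      \<open>\<kappa>\<close> times the scale apart, so one of them is at least half that far from
      the centre of \<open>v'\<close>.\<close>
    obtain q where q: "q = ?w \<or> q = ?y" "\<kappa> * exp (- real (fst v)) \<le> 2 * d ?w' q"
      using mate(2)[OF v(1)] Z.triangle[of ?w ?w' ?y] Z.commute[of ?w ?w'] in_S
      by (smt (verit))
    have "d ?w' ?y' \<le> exp (- real m) * exp (- real (fst v))"
      using mate(3)[OF v(2)] le by simp
    also have "\<dots> \<le> l * \<kappa> / 2 * exp (- real (fst v))"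
      using em by (intro mult_right_mono) auto
    also have "\<dots> \<le> l * d ?w' q"
      using q(2) l(1) by (simp add: mult.assoc)
    finally have "width v' \<le> \<epsilon> * \<rho> ?w' q"
      unfolding width_def using q(1) in_S by (intro l(2)) auto
    also have "\<dots> \<le> \<epsilon> * ((H + 1) * width v)"
    proof (rule mult_left_mono)
      have "\<rho> ?w' q \<le> \<rho> ?w' ?w + \<rho> ?w q"
        using in_S q(1) by (intro W.triangle) auto
      moreover have "\<rho> ?w q \<le> width v"
        using q(1) width_pos[OF v(1)] in_S by (auto simp: width_def)
      ultimately show "\<rho> ?w' q \<le> (H + 1) * width v"
        using ww' W.commute[of ?w ?w'] by (simp add: algebra_simps)
    qed (use \<open>\<epsilon> > 0\<close> in simp)
    also have "\<dots> = width v / 2"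
      using H(1) by (simp add: \<epsilon>_def field_simps)
    finally show "2 * width v' \<le> width v" by simp
  qed
qed

text \<open>For cells of comparable width, fixing the level modulo \<open>m\<close> makes the inner balls disjoint.\<close>

lemma width_class_sum:
  obtains C where "C > 0"
    "\<And>V z R b. finite V \<Longrightarrow> V \<subseteq> vertices \<Longrightarrow> z \<in> S \<Longrightarrow> (\<And>v. v \<in> V \<Longrightarrow> \<rho> z (snd v) \<le> R) \<Longrightarrow>
      b \<le> R \<Longrightarrow> (\<And>v. v \<in> V \<Longrightarrow> b < 2 * width v \<and> width v \<le> b) \<Longrightarrow> (\<Sum>v\<in>V. width v powr Q) \<le> C * R powr Q"
proof -
  obtain c where c: "0 < c" "c \<le> 1/2"
    "\<And>v x. v \<in> vertices \<Longrightarrow> x \<in> W.mball (snd v) (c * width v) \<Longrightarrow> d (snd v) x < exp (- real (fst v)) / 2"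
    using width_ball by blast
  obtain m :: nat where m: "m \<ge> 1"
    "\<And>v v' x. v \<in> vertices \<Longrightarrow> v' \<in> vertices \<Longrightarrow> x \<in> S \<Longrightarrow> fst v + m \<le> fst v' \<Longrightarrow>
      d (snd v) x < exp (- real (fst v)) / 2 \<Longrightarrow> d (snd v') x < exp (- real (fst v')) / 2 \<Longrightarrow> 2 * width v' \<le> width v"
    using width_decay by blast
  \<comment> \<open>There are \<open>m\<close> residue classes of levels; in each the balls of
    radius \<open>c * width v\<close> are packed into a ball of radius \<open>2 * R\<close>.\<close>
  define C where "C = real m * (K * 2 powr Q / c powr Q)"
  show ?thesis
  proof (rule that[of C])
    show "C > 0" using m(1) K c(1) by (simp add: C_def)
    fix V z R b
    assume V: "finite V" "V \<subseteq> vertices" "z \<in> S" "\<And>v. v \<in> V \<Longrightarrow> \<rho> z (snd v) \<le> R" "b \<le> R"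
      "\<And>v. v \<in> V \<Longrightarrow> b < 2 * width v \<and> width v \<le> b"
    show "(\<Sum>v\<in>V. width v powr Q) \<le> C * R powr Q"
    proof (cases "V = {}")
      case False
      then obtain v0 where "v0 \<in> V" by blast
      then have "0 \<le> R"
        using V(4)[of v0] W.nonneg[of z "snd v0"] by linarith
      have one_class: "(\<Sum>v\<in>{v \<in> V. fst v mod m = i}. width v powr Q) \<le> K * 2 powr Q / c powr Q * R powr Q" for i
      proof -
        let ?I = "{v \<in> V. fst v mod m = i}"
        have disj: "W.mball (snd v) (c * width v) \<inter> W.mball (snd v') (c * width v') = {}"
          if v: "v \<in> ?I" "v' \<in> ?I" "v \<noteq> v'" "fst v \<le> fst v'" for v v'
        proof (rule ccontr)
          assume "\<not> ?thesis"
          then obtain x where x: "x \<in> W.mball (snd v) (c * width v)" "x \<in> W.mball (snd v') (c * width v')"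
            by blast
          have vV: "v \<in> vertices" "v' \<in> vertices" using v V(2) by auto
          have dx: "d (snd v) x < exp (- real (fst v)) / 2" "d (snd v') x < exp (- real (fst v')) / 2"
            using c(3) vV x by auto
          show False
          \<comment> \<open>On one level the separation of the net is violated. On different levels
            the congruence gives a gap of at least \<open>m\<close>, so the widths differ by a
            factor 2, although both lie above b/2 and at most at \<open>b\<close>.\<close>
          proof (cases "fst v = fst v'")
            case True
            then have "snd v \<noteq> snd v'" using v(3) by (simp add: prod_eq_iff)
            then have "exp (- real (fst v)) \<le> d (snd v) (snd v')"
              using vV True by (intro net(2)) (auto simp: vertices_def)
            also have "\<dots> \<le> d (snd v) x + d x (snd v')"
              using x vV by (intro Z.triangle) auto
            also have "\<dots> < exp (- real (fst v))"
              using dx True Z.commute[of x "snd v'"] by simp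
            finally show False by simp
          next
            case False
            have "m dvd fst v' - fst v"
              using v by (auto simp: mod_eq_dvd_iff_nat)
            then have "m \<le> fst v' - fst v"
              using False v(4) by (intro dvd_imp_le) auto
            then have "2 * width v' \<le> width v"
              using m(2)[of v v' x] vV x dx v(4) by auto
            then show False
              using V(6)[of v] V(6)[of v'] v by auto
          qed
        qed
        have "(\<Sum>v\<in>?I. (c * width v) powr Q) \<le> K * (2 * R) powr Q"
        proof (rule packing[OF _ V(3)])
          show "finite ?I" "0 \<le> 2 * R" using V(1) \<open>0 \<le> R\<close> by auto
          fix v assume v: "v \<in> ?I"
          then have vV: "v \<in> vertices" using V(2) by auto
          have "c * width v \<le> 1/2 * width v"
            using c(2) width_pos[OF vV] by (intro mult_right_mono) auto
          then have "c * width v \<le> D / 2" "c * width v \<le> width v"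
            using width_pos[OF vV] width_le_D[OF vV] by linarith+
          moreover have "width v \<le> R" "\<rho> z (snd v) \<le> R"
            using V(4)[of v] V(5) V(6)[of v] v by auto
          ultimately have "c * width v \<le> D / 2 \<and> \<rho> z (snd v) + c * width v \<le> 2 * R"
            by linarith
          then show "snd v \<in> S \<and> 0 < c * width v \<and> c * width v \<le> D / 2 \<and> \<rho> z (snd v) + c * width v \<le> 2 * R"
            using width_pos[OF vV] c(1) vV by simp
        next
          show "pairwise (\<lambda>v v'. W.mball (snd v) (c * width v) \<inter> W.mball (snd v') (c * width v') = {}) ?I"
            unfolding pairwise_def
          proof (intro ballI impI)
            fix v v' assume v: "v \<in> ?I" "v' \<in> ?I" "v \<noteq> v'"
            consider "fst v \<le> fst v'" | "fst v' \<le> fst v" by linarith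
            then show "W.mball (snd v) (c * width v) \<inter> W.mball (snd v') (c * width v') = {}"
            proof cases
              case 1
              then show ?thesis by (rule disj[OF v])
            next
              case 2
              then have "W.mball (snd v') (c * width v') \<inter> W.mball (snd v) (c * width v) = {}"
                by (rule disj[OF v(2,1) v(3)[symmetric]])
              then show ?thesis by (simp only: Int_commute)
            qed
          qed
        qed
        moreover have "(\<Sum>v\<in>?I. (c * width v) powr Q) = c powr Q * (\<Sum>v\<in>?I. width v powr Q)"
          unfolding sum_distrib_left using c(1) V(2) width_pos
          by (intro sum.cong) (auto simp: powr_mult dest!: less_imp_le)
        ultimately show ?thesis
          using c(1) \<open>0 \<le> R\<close> by (simp add: powr_mult field_simps)
      qed
      have "(\<Sum>v\<in>V. width v powr Q) = (\<Sum>i<m. \<Sum>v\<in>{v \<in> V. fst v mod m = i}. width v powr Q)"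
        using V(1) m(1) by (intro sum.group[symmetric]) auto
      also have "\<dots> \<le> (\<Sum>i<m. K * 2 powr Q / c powr Q * R powr Q)"
        by (intro sum_mono one_class)
      finally show ?thesis
        by (simp add: C_def)
    qed (use \<open>C > 0\<close> in simp)
  qed
qed

text \<open>Vertices are sorted by dyadic width. In class j the factor
  \<open>width v powr (p - Q)\<close> is at most that of \<open>R / 2 ^ j\<close>, and
  \<open>width_class_sum\<close> bounds what remains uniformly in j. Since \<open>p > Q\<close>, the
  classes sum to a geometric series of ratio \<open>\<beta>\<close>.\<close>

lemma energy_bound:
  assumes "p > Q"
  obtains C where "C > 0"
    "\<And>V z R. finite V \<Longrightarrow> V \<subseteq> vertices \<Longrightarrow> z \<in> S \<Longrightarrow>
      (\<And>v. v \<in> V \<Longrightarrow> \<rho> z (snd v) \<le> R \<and> width v \<le> R) \<Longrightarrow> (\<Sum>v\<in>V. width v powr p) \<le> C * R powr p"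
proof -
  obtain C where C: "C > 0"
    "\<And>V z R b. finite V \<Longrightarrow> V \<subseteq> vertices \<Longrightarrow> z \<in> S \<Longrightarrow> (\<And>v. v \<in> V \<Longrightarrow> \<rho> z (snd v) \<le> R) \<Longrightarrow>
      b \<le> R \<Longrightarrow> (\<And>v. v \<in> V \<Longrightarrow> b < 2 * width v \<and> width v \<le> b) \<Longrightarrow> (\<Sum>v\<in>V. width v powr Q) \<le> C * R powr Q"
    using width_class_sum by blast
  define \<beta> where "\<beta> = (1/2) powr (p - Q)"
  have \<beta>: "0 < \<beta>" "\<beta> < 1"
    unfolding \<beta>_def using assms powr_less_mono2[of "p - Q" "1/2" 1] by auto
  show ?thesis
  proof (rule that[of "C / (1 - \<beta>)"])
    show "0 < C / (1 - \<beta>)" using C(1) \<beta> by simp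
    fix V z R
    assume V: "finite V" "V \<subseteq> vertices" "z \<in> S" "\<And>v. v \<in> V \<Longrightarrow> \<rho> z (snd v) \<le> R \<and> width v \<le> R"
    show "(\<Sum>v\<in>V. width v powr p) \<le> C / (1 - \<beta>) * R powr p"
    proof (cases "V = {}")
      case False
      then obtain v0 where "v0 \<in> V" by blast
      then have "0 < R"
        using V(2) V(4)[of v0] width_pos[of v0] by force
      \<comment> \<open>The dyadic class of \<open>v\<close>: the width lies above R/2^(k+1) and at
        most at R/2^k. For k = 0 the upper bound is the hypothesis that widths are at most
        \<open>R\<close>; otherwise it is minimality.\<close>
      define k where "k v = (LEAST k. R / 2 ^ Suc k < width v)" for v
      have k: "R / 2 ^ k v < 2 * width v" "width v \<le> R / 2 ^ k v" if "v \<in> V" for v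
      proof -
        have "0 < width v / R" using width_pos[of v] V(2) that \<open>0 < R\<close> by auto
        then obtain n where "(1/2) ^ n < width v / R"
          using real_arch_pow_inv[of "width v / R" "1/2"] by auto
        moreover have "(1/2) ^ Suc n \<le> (1/2 :: real) ^ n" by simp
        ultimately have "(1/2) ^ Suc n < width v / R" by linarith
        then have "R / 2 ^ Suc n < width v"
          using \<open>0 < R\<close> by (simp add: power_one_over field_simps)
        then have "R / 2 ^ Suc (k v) < width v"
          unfolding k_def by (rule LeastI)
        then show "R / 2 ^ k v < 2 * width v" by simp
        show "width v \<le> R / 2 ^ k v"
        proof (cases "k v")
          case 0
          then show ?thesis using V(4)[OF that] by simp
        next
          case (Suc j)
          then have "\<not> R / 2 ^ Suc j < width v"
            using not_less_Least[of j "\<lambda>k. R / 2 ^ Suc k < width v"] by (simp add: k_def)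
          then show ?thesis using Suc by simp
        qed
      qed
      have class_sum: "(\<Sum>v\<in>{v \<in> V. k v = j}. width v powr p) \<le> C * R powr p * \<beta> ^ j" for j
      proof -
        have "(\<Sum>v\<in>{v \<in> V. k v = j}. width v powr p)
            \<le> (\<Sum>v\<in>{v \<in> V. k v = j}. (R / 2 ^ j) powr (p - Q) * width v powr Q)"
        proof (rule sum_mono)
          fix v assume v: "v \<in> {v \<in> V. k v = j}"
          have "width v powr p = width v powr (p - Q) * width v powr Q"
            by (simp flip: powr_add)
          also have "\<dots> \<le> (R / 2 ^ j) powr (p - Q) * width v powr Q"
            using k[of v] v V(2) width_pos[of v] assms by (intro mult_right_mono powr_mono2) auto
          finally show "width v powr p \<le> (R / 2 ^ j) powr (p - Q) * width v powr Q" .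
        qed
        also have "\<dots> = (R / 2 ^ j) powr (p - Q) * (\<Sum>v\<in>{v \<in> V. k v = j}. width v powr Q)"
          by (simp add: sum_distrib_left)
        also have "\<dots> \<le> (R / 2 ^ j) powr (p - Q) * (C * R powr Q)"
        proof (intro mult_left_mono C(2)[of "{v \<in> V. k v = j}" z R "R / 2 ^ j"])
          show "R / 2 ^ j \<le> R"
            using \<open>0 < R\<close> by (simp add: field_simps)
        qed (use V k in auto)
        also have "(R / 2 ^ j) powr (p - Q) = R powr (p - Q) * \<beta> ^ j"
        proof -
          have "(R / 2 ^ j) powr (p - Q) = R powr (p - Q) * ((1/2) ^ j) powr (p - Q)"
            using \<open>0 < R\<close> by (simp add: powr_mult[symmetric] power_one_over)
          also have "((1/2) ^ j) powr (p - Q) = \<beta> ^ j"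
            unfolding \<beta>_def by (simp add: powr_powr mult.commute flip: powr_realpow)
          finally show ?thesis .
        qed
        also have "R powr (p - Q) * \<beta> ^ j * (C * R powr Q) = C * (R powr (p - Q) * R powr Q) * \<beta> ^ j"
          by (simp add: mult_ac)
        finally show ?thesis
          by (simp flip: powr_add)
      qed
      have "(\<Sum>v\<in>V. width v powr p) = (\<Sum>j\<in>k ` V. \<Sum>v\<in>{v \<in> V. k v = j}. width v powr p)"
        using V(1) by (intro sum.group[symmetric]) auto
      also have "\<dots> \<le> (\<Sum>j\<in>k ` V. C * R powr p * \<beta> ^ j)"
        by (intro sum_mono class_sum)
      also have "\<dots> = C * R powr p * (\<Sum>j\<in>k ` V. \<beta> ^ j)"
        by (simp add: sum_distrib_left)
      also have "\<dots> \<le> C * R powr p * (\<Sum>j. \<beta> ^ j)"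
        using C(1) V(1) \<beta> by (intro mult_left_mono sum_le_suminf) (auto intro: summable_geometric)
      also have "(\<Sum>j. \<beta> ^ j) = 1 / (1 - \<beta>)"
        using \<beta> by (intro suminf_geometric) auto
      finally show ?thesis by simp
    qed (use C(1) \<beta> in simp)
  qed
qed

section \<open>Concentration of finite vertex sets near a point\<close>

definition reach :: "'a \<Rightarrow> nat \<times> 'a \<Rightarrow> real" where
  "reach z v = \<rho> z (snd v) + width v"

text \<open>A doubling property. A maximal subset with distances above s/4 is an s/4-net, and the
  balls of radius s/8 about its points are disjoint and lie within 3s of \<open>z\<close>; packing
  allows at most K times 24 to the power Q of them.\<close>

lemma small_net:
  obtains n0 :: real where "n0 \<ge> 1"
    "\<And>A z s. finite A \<Longrightarrow> A \<subseteq> S \<Longrightarrow> z \<in> S \<Longrightarrow> 0 < s \<Longrightarrow> s \<le> 2 * D \<Longrightarrow> (\<And>x. x \<in> A \<Longrightarrow> \<rho> z x \<le> 2 * s) \<Longrightarrow>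
      \<exists>P\<subseteq>A. real (card P) \<le> n0 \<and> (\<forall>x\<in>A. \<exists>y\<in>P. \<rho> y x \<le> s / 4)"
proof (rule that[of "max 1 (K * 24 powr Q)"])
  fix A z s
  assume A: "finite A" "A \<subseteq> S" "z \<in> S" "0 < s" "s \<le> 2 * D" "\<And>x. x \<in> A \<Longrightarrow> \<rho> z x \<le> 2 * s"
  define \<P> where "\<P> = {P. P \<subseteq> A \<and> pairwise (\<lambda>x y. s / 4 < \<rho> x y) P}"
  have "finite \<P>" "{} \<in> \<P>"
    using A(1) by (auto simp: \<P>_def)
  then obtain P where P: "P \<in> \<P>" "\<And>P'. P' \<in> \<P> \<Longrightarrow> P \<subseteq> P' \<Longrightarrow> P = P'"
    using finite_has_maximal2[of \<P> "{}"] by metis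
  have PA: "P \<subseteq> A" and sep: "pairwise (\<lambda>x y. s / 4 < \<rho> x y) P"
    using P(1) by (auto simp: \<P>_def)
  have "\<exists>y\<in>P. \<rho> y x \<le> s / 4" if "x \<in> A" for x
  proof (rule ccontr)
    assume far: "\<not> ?thesis"
    then have "insert x P \<in> \<P>"
      using PA sep that A(2) W.commute by (auto simp: \<P>_def pairwise_insert not_le)
    then have "x \<in> P"
      using P(2)[of "insert x P"] by auto
    then have "\<not> \<rho> x x \<le> s / 4"
      using far by blast
    then show False
      using A(2,4) that by (simp add: subset_iff)
  qed
  moreover have "real (card P) \<le> K * 24 powr Q"
  proof -
    \<comment> \<open>Level 0 is a dummy that turns points into indices for \<open>packing\<close>;
      \<open>s \<le> 2 * D\<close> keeps the radius s/8 below \<open>D / 2\<close>.\<close>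
    have "(\<Sum>v\<in>{0 :: nat} \<times> P. (s / 8) powr Q) \<le> K * (3 * s) powr Q"
    proof (rule packing[OF _ A(3)])
      show "finite ({0 :: nat} \<times> P)" "0 \<le> 3 * s"
        using A finite_subset[OF PA] by auto
      show "snd v \<in> S \<and> 0 < s / 8 \<and> s / 8 \<le> D / 2 \<and> \<rho> z (snd v) + s / 8 \<le> 3 * s" if "v \<in> {0 :: nat} \<times> P" for v
        using that A(2,4,5) A(6)[of "snd v"] PA by auto
      have "W.mball x (s / 8) \<inter> W.mball y (s / 8) = {}" if xy: "x \<in> P" "y \<in> P" "x \<noteq> y" for x y
      proof (rule ccontr)
        assume "\<not> ?thesis"
        then obtain u where u: "u \<in> W.mball x (s / 8)" "u \<in> W.mball y (s / 8)"
          by blast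
        then have "\<rho> x y \<le> \<rho> x u + \<rho> y u"
          by (metis W.commute W.in_mball W.triangle)
        moreover have "s / 4 < \<rho> x y"
          using sep xy by (simp add: pairwise_def)
        ultimately show False
          using u by simp
      qed
      then show "pairwise (\<lambda>v v'. W.mball (snd v) (s / 8) \<inter> W.mball (snd v') (s / 8) = {}) ({0 :: nat} \<times> P)"
        by (auto simp: pairwise_def)
    qed
    also have "3 * s = 24 * (s / 8)" by simp
    also have "K * (24 * (s / 8)) powr Q = K * 24 powr Q * (s / 8) powr Q"
      unfolding powr_mult[of 24] by (simp only: mult_ac)
    finally show ?thesis
      using A(4) by (simp add: card_cartesian_product)
  qed
  ultimately show "\<exists>P\<subseteq>A. real (card P) \<le> max 1 (K * 24 powr Q) \<and> (\<forall>x\<in>A. \<exists>y\<in>P. \<rho> y x \<le> s / 4)"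
    by (intro exI[of _ P] conjI PA ballI max.coboundedI2)
qed simp

text \<open>The scale \<open>s\<close> is essentially the smallest at which some cluster carries a proportion \<open>\<epsilon>\<close> of the
  vertices; the cluster of twice the radius is covered by boundedly many lighter clusters and boundedly
  many wide vertices.\<close>

lemma concentration:
  obtains \<epsilon> M :: real where "0 < \<epsilon>" "\<epsilon> \<le> 1/2"
    "\<And>V. finite V \<Longrightarrow> V \<subseteq> vertices \<Longrightarrow> V \<noteq> {} \<Longrightarrow> M \<le> real (card V) \<Longrightarrow>
      \<exists>z\<in>S. \<exists>s>0. \<epsilon> * real (card V) \<le> real (card {v\<in>V. reach z v \<le> s}) \<and>
        1/2 * real (card V) \<le> real (card {v\<in>V. 2 * s < reach z v})"
proof -
  obtain n0 :: real where n0: "n0 \<ge> 1"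
    "\<And>A z s. finite A \<Longrightarrow> A \<subseteq> S \<Longrightarrow> z \<in> S \<Longrightarrow> 0 < s \<Longrightarrow> s \<le> 2 * D \<Longrightarrow> (\<And>x. x \<in> A \<Longrightarrow> \<rho> z x \<le> 2 * s) \<Longrightarrow>
      \<exists>P\<subseteq>A. real (card P) \<le> n0 \<and> (\<forall>x\<in>A. \<exists>y\<in>P. \<rho> y x \<le> s / 4)"
    using small_net by blast
  \<comment> \<open>The exponent \<open>Q + 1\<close> is merely a convenient one above
    \<open>Q\<close>; this energy serves to count wide vertices.\<close>
  obtain C where C: "C > 0"
    "\<And>V z R. finite V \<Longrightarrow> V \<subseteq> vertices \<Longrightarrow> z \<in> S \<Longrightarrow>
      (\<And>v. v \<in> V \<Longrightarrow> \<rho> z (snd v) \<le> R \<and> width v \<le> R) \<Longrightarrow> (\<Sum>v\<in>V. width v powr (Q + 1)) \<le> C * R powr (Q + 1)"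
    using energy_bound[of "Q + 1"] less_add_one[of Q] by blast
  \<comment> \<open>With these constants, \<open>n0\<close> light clusters hold at most a quarter of
    the vertices, and the wide vertices are at most another quarter.\<close>
  define \<epsilon> where "\<epsilon> = 1 / (4 * n0)"
  define M where "M = 4 * (C * 8 powr (Q + 1))"
  have \<epsilon>: "0 < \<epsilon>" "\<epsilon> \<le> 1/4"
    using n0(1) by (auto simp: \<epsilon>_def field_simps)
  show ?thesis
  proof (rule that[of \<epsilon> M])
    show "0 < \<epsilon>" "\<epsilon> \<le> 1/2" using \<epsilon> by auto
    fix V assume V: "finite V" "V \<subseteq> vertices" "V \<noteq> {}" "M \<le> real (card V)"
    define n where "n = real (card V)"
    have "n > 0" using V by (simp add: n_def card_gt_0_iff)
    define heavy where "heavy k \<longleftrightarrow> (\<exists>z\<in>S. \<epsilon> * n \<le> real (card {v\<in>V. reach z v \<le> 2 * D / 2 ^ k}))" for k :: nat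
    \<comment> \<open>At scale \<open>2 * D\<close> everything is within reach, distances and widths
      being at most \<open>D\<close>. Below the least width nothing is, so heaviness is lost at some
      halving.\<close>
    have "heavy 0"
    proof -
      obtain v0 where "v0 \<in> V" using V(3) by blast
      then have v0: "snd v0 \<in> S" using V(2) by auto
      have "{v\<in>V. reach (snd v0) v \<le> 2 * D / 2 ^ 0} = V"
        using V(2) D(2)[OF v0 vertices_in] width_le_D by (fastforce simp: reach_def)
      moreover have "\<epsilon> * n \<le> 1 * n"
        using \<epsilon> \<open>n > 0\<close> by (intro mult_right_mono) auto
      ultimately show ?thesis
        unfolding heavy_def using v0 by (intro bexI[of _ "snd v0"]) (simp_all add: n_def)
    qed
    moreover have "\<exists>k. \<not> heavy k"
    proof -
      define w where "w = Min (width ` V)"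
      have w: "w > 0" "\<And>v. v \<in> V \<Longrightarrow> w \<le> width v"
        unfolding w_def using V width_pos by auto
      obtain k where "(1/2) ^ k < w / (2 * D)"
        using real_arch_pow_inv[of "w / (2 * D)" "1/2"] w D(1) by auto
      then have k: "2 * D / 2 ^ k < w"
        using D(1) by (simp add: power_one_over field_simps)
      have "2 * D / 2 ^ k < reach z v" if "v \<in> V" for v z
        using w(2)[OF that] k W.nonneg[of z "snd v"] unfolding reach_def by linarith
      then have empty: "{v\<in>V. reach z v \<le> 2 * D / 2 ^ k} = {}" for z
        unfolding Collect_empty_eq not_le[symmetric] by blast
      have "\<not> heavy k"
        unfolding heavy_def empty using \<epsilon> \<open>n > 0\<close> by (simp add: not_le)
      then show ?thesis ..
    qed
    ultimately obtain k where k: "heavy k" "\<not> heavy (Suc k)"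
      by (metis nat_induct)
    define s where "s = 2 * D / 2 ^ k"
    have s: "0 < s" "s \<le> 2 * D"
      using D(1) by (auto simp: s_def field_simps)
    obtain z where z: "z \<in> S" "\<epsilon> * n \<le> real (card {v\<in>V. reach z v \<le> s})"
      using k(1) by (auto simp: heavy_def s_def)
    have light: "real (card {v\<in>V. reach x v \<le> s / 2}) \<le> \<epsilon> * n" if "x \<in> S" for x
      using k(2) that by (force simp: heavy_def s_def)
    define A where "A = {v\<in>V. reach z v \<le> 2 * s}"
    have A: "finite A" "A \<subseteq> vertices" using V by (auto simp: A_def)
    have A_le: "\<rho> z (snd v) \<le> 2 * s \<and> width v \<le> 2 * s" if "v \<in> A" for v
    proof -
      have "v \<in> vertices" "reach z v \<le> 2 * s"
        using that A(2) by (auto simp: A_def)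
      then show ?thesis
        using width_pos[of v] W.nonneg[of z "snd v"] unfolding reach_def by (intro conjI; linarith)
    qed
    have "\<exists>P\<subseteq>snd ` A. real (card P) \<le> n0 \<and> (\<forall>x\<in>snd ` A. \<exists>y\<in>P. \<rho> y x \<le> s / 4)"
      using A vertices_in A_le z(1) s by (intro n0(2)) (blast | simp)+
    then obtain P where P: "P \<subseteq> snd ` A" "real (card P) \<le> n0" "\<And>v. v \<in> A \<Longrightarrow> \<exists>y\<in>P. \<rho> y (snd v) \<le> s / 4"
      by blast
    have PS: "P \<subseteq> S" "finite P"
      using P(1) A(1) finite_subset[OF P(1)] A(2) vertices_in by blast+
    define B where "B = {v \<in> A. s / 4 \<le> width v}"
    \<comment> \<open>Each wide vertex contributes at least s/4 to the power Q+1 to an energy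
      bounded by that of radius 2s, so the count of wide vertices is independent of
      \<open>s\<close>.\<close>
    have "real (card B) * (s / 4) powr (Q + 1) \<le> C * 8 powr (Q + 1) * (s / 4) powr (Q + 1)"
    proof -
      have "real (card B) * (s / 4) powr (Q + 1) = (\<Sum>v\<in>B. (s / 4) powr (Q + 1))"
        by simp
      also have "\<dots> \<le> (\<Sum>v\<in>B. width v powr (Q + 1))"
        using s Q by (intro sum_mono powr_mono2) (auto simp: B_def)
      also have "\<dots> \<le> C * (2 * s) powr (Q + 1)"
        using A A_le z(1) by (intro C(2)) (auto simp: B_def)
      also have "2 * s = 8 * (s / 4)" by simp
      also have "(8 * (s / 4)) powr (Q + 1) = 8 powr (Q + 1) * (s / 4) powr (Q + 1)"
        by (rule powr_mult)
      finally show ?thesis by (simp add: mult.assoc)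
    qed
    then have "real (card B) \<le> n / 4"
      using s V(4) by (simp add: M_def n_def)
    \<comment> \<open>A vertex of width below s/4 whose centre is within s/4 of a net point
      \<open>y\<close> has reach at most s/2 from \<open>y\<close>.\<close>
    have "A \<subseteq> (\<Union>x\<in>P. {v\<in>V. reach x v \<le> s / 2}) \<union> B"
    proof
      fix v assume v: "v \<in> A"
      then obtain y where "y \<in> P" "\<rho> y (snd v) \<le> s / 4" using P(3) by blast
      then show "v \<in> (\<Union>x\<in>P. {v\<in>V. reach x v \<le> s / 2}) \<union> B"
        using v by (cases "s / 4 \<le> width v") (auto simp: B_def A_def reach_def intro!: bexI[of _ y])
    qed
    then have "card A \<le> card ((\<Union>x\<in>P. {v\<in>V. reach x v \<le> s / 2}) \<union> B)"
      using V(1) PS(2) A(1) by (intro card_mono) (auto simp: B_def)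
    also have "\<dots> \<le> card (\<Union>x\<in>P. {v\<in>V. reach x v \<le> s / 2}) + card B"
      by (rule card_Un_le)
    also have "card (\<Union>x\<in>P. {v\<in>V. reach x v \<le> s / 2}) \<le> (\<Sum>x\<in>P. card {v\<in>V. reach x v \<le> s / 2})"
      using PS(2) by (rule card_UN_le)
    finally have "real (card A) \<le> (\<Sum>x\<in>P. real (card {v\<in>V. reach x v \<le> s / 2})) + real (card B)"
      by (simp flip: of_nat_sum of_nat_add)
    also have "(\<Sum>x\<in>P. real (card {v\<in>V. reach x v \<le> s / 2})) \<le> (\<Sum>x\<in>P. \<epsilon> * n)"
      using light PS by (intro sum_mono) auto
    also have "\<dots> \<le> n0 * (\<epsilon> * n)"
      using P(2) \<epsilon> \<open>n > 0\<close> by (simp add: mult_right_mono)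
    also have "\<dots> = n / 4"
      using n0(1) by (simp add: \<epsilon>_def)
    finally have "real (card A) \<le> n / 2"
      using \<open>real (card B) \<le> n / 4\<close> by simp
    moreover have "card {v\<in>V. 2 * s < reach z v} = card V - card A"
      using V(1) by (subst card_Diff_subset[symmetric]) (auto simp: A_def intro!: arg_cong[of _ _ card])
    moreover have "card A \<le> card V"
      using V(1) by (intro card_mono) (auto simp: A_def)
    ultimately have "1/2 * n \<le> real (card {v\<in>V. 2 * s < reach z v})"
      by (simp add: n_def of_nat_diff)
    then show "\<exists>z\<in>S. \<exists>s>0. \<epsilon> * real (card V) \<le> real (card {v\<in>V. reach z v \<le> s}) \<and>
        1/2 * real (card V) \<le> real (card {v\<in>V. 2 * s < reach z v})"
      using z s(1) by (auto simp: n_def)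
  qed
qed

section \<open>Gradient and energy of bump functions\<close>

text \<open>Adjacent scales differ by a factor of at most e, hence 3. So the neighbouring centre
  lies within 1 + 3 = 4 times the scale of \<open>v\<close> and the neighbouring mate within 4 + 3 =
  7 times, and \<open>dist_le_width\<close> at 7 controls both. The sum uses the distance to the
  centre twice and to the mate once, whence \<open>3 * H\<close>.\<close>

lemma adjacent_width:
  obtains L where "L \<ge> 1"
    "\<And>v v'. v \<in> vertices \<Longrightarrow> v' \<in> vertices \<Longrightarrow> \<bar>int (fst v) - int (fst v')\<bar> \<le> 1 \<Longrightarrow>
      d (snd v) (snd v') \<le> exp (- real (fst v)) + exp (- real (fst v')) \<Longrightarrow>
      \<rho> (snd v) (snd v') + width v' \<le> L * width v"
proof -
  obtain H where H: "H \<ge> 1"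
    "\<And>v x. v \<in> vertices \<Longrightarrow> x \<in> S \<Longrightarrow> d (snd v) x \<le> 7 * exp (- real (fst v)) \<Longrightarrow> \<rho> (snd v) x \<le> H * width v"
    using dist_le_width[of 7] by blast
  show ?thesis
  proof (rule that[of "3 * H"])
    show "3 * H \<ge> 1" using H(1) by simp
    fix v v'
    assume v: "v \<in> vertices" "v' \<in> vertices" "\<bar>int (fst v) - int (fst v')\<bar> \<le> 1"
      "d (snd v) (snd v') \<le> exp (- real (fst v)) + exp (- real (fst v'))"
    note in_S = vertices_in[OF v(1)] vertices_in[OF v(2)] mate(1)[OF v(2)]
    have "exp (- real (fst v')) \<le> exp (1 + - real (fst v))"
      using v(3) by simp
    also have "\<dots> \<le> 3 * exp (- real (fst v))"
      unfolding exp_add using exp_le by (intro mult_right_mono) auto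
    finally have e: "exp (- real (fst v')) \<le> 3 * exp (- real (fst v))" .
    have 1: "d (snd v) (snd v') \<le> 4 * exp (- real (fst v))"
      using e v(4) by linarith
    then have "\<rho> (snd v) (snd v') \<le> H * width v"
      using in_S v by (intro H(2)) (auto intro: order_trans)
    moreover have "d (snd v) (mate v') \<le> 7 * exp (- real (fst v))"
      using 1 e mate(3)[OF v(2)] Z.triangle[OF in_S] by linarith
    then have "\<rho> (snd v) (mate v') \<le> H * width v"
      using in_S v by (intro H(2)) auto
    moreover have "width v' \<le> \<rho> (snd v) (snd v') + \<rho> (snd v) (mate v')"
      unfolding width_def using W.triangle[OF in_S(2,1,3)] W.commute[of "snd v"] by simp
    ultimately show "\<rho> (snd v) (snd v') + width v' \<le> 3 * H * width v"
      by simp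
  qed
qed

definition bump :: "'a \<Rightarrow> real \<Rightarrow> nat \<times> 'a \<Rightarrow> real" where
  "bump z s v = max 0 (min 1 (2 - reach z v / s))"

lemma
  assumes "0 < s"
  shows bump_eq_1: "reach z v \<le> s \<Longrightarrow> bump z s v = 1"
    and bump_eq_0: "2 * s \<le> reach z v \<Longrightarrow> bump z s v = 0"
  using assms pos_divide_le_eq[of s "reach z v" 1] pos_le_divide_eq[of s 2 "reach z v"]
  by (simp_all add: bump_def)

text \<open>Intersection of the two balls of adjacent cells enters only through the resulting bound
  on the distance of their centres.\<close>

definition filling_graph :: "(nat \<times> 'a) pair_pre_digraph \<Rightarrow> bool" where
  "filling_graph \<Gamma> \<longleftrightarrow> finite (pverts \<Gamma>) \<and> finite (parcs \<Gamma>) \<and> pverts \<Gamma> \<subseteq> vertices \<and>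
     (\<forall>(v, v')\<in>parcs \<Gamma>. v \<in> vertices \<and> v' \<in> vertices \<and> \<bar>int (fst v) - int (fst v')\<bar> \<le> 1 \<and>
        d (snd v) (snd v') \<le> exp (- real (fst v)) + exp (- real (fst v')))"

text \<open>Along an arc the reach changes by at most \<open>(L + 1) * width v\<close>, and
  truncation to [0,1] does not increase differences, so the gradient is at most this over
  \<open>s\<close>. It vanishes at vertices of large reach, whose neighbours still have reach at
  least \<open>2 * s\<close>. On the others \<open>energy_bound\<close> grows like s to the power p,
  which cancels the denominator.\<close>

lemma bump_energy:
  assumes "p > Q" "p \<ge> 1"
  obtains E where "E > 0"
    "\<And>\<Gamma> z s. filling_graph \<Gamma> \<Longrightarrow> z \<in> S \<Longrightarrow> s > 0 \<Longrightarrow>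
      (\<Sum>v\<in>pverts \<Gamma>. graph_gradient \<Gamma> (bump z s) v powr p) \<le> E"
proof -
  obtain C where C: "C > 0"
    "\<And>V z R. finite V \<Longrightarrow> V \<subseteq> vertices \<Longrightarrow> z \<in> S \<Longrightarrow>
      (\<And>v. v \<in> V \<Longrightarrow> \<rho> z (snd v) \<le> R \<and> width v \<le> R) \<Longrightarrow> (\<Sum>v\<in>V. width v powr p) \<le> C * R powr p"
    using energy_bound[OF assms(1)] by blast
  obtain L where L: "L \<ge> 1"
    "\<And>v v'. v \<in> vertices \<Longrightarrow> v' \<in> vertices \<Longrightarrow> \<bar>int (fst v) - int (fst v')\<bar> \<le> 1 \<Longrightarrow>
      d (snd v) (snd v') \<le> exp (- real (fst v)) + exp (- real (fst v')) \<Longrightarrow>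
      \<rho> (snd v) (snd v') + width v' \<le> L * width v"
    using adjacent_width by blast
  show ?thesis
  proof (rule that[of "((L + 1) * (2 + 2 * L)) powr p * C"])
    show "((L + 1) * (2 + 2 * L)) powr p * C > 0"
      using L(1) C(1) by simp
    fix \<Gamma> z and s :: real assume \<Gamma>: "filling_graph \<Gamma>" and z: "z \<in> S" and s: "s > 0"
    let ?V = "pverts \<Gamma>" and ?F = "bump z s"
    have fin: "finite ?V" "finite (parcs \<Gamma>)" and V: "?V \<subseteq> vertices"
      using \<Gamma> by (auto simp: filling_graph_def)
    have arc: "v \<in> vertices" "v' \<in> vertices" "\<rho> (snd v) (snd v') + width v' \<le> L * width v"
        "\<rho> (snd v) (snd v') + width v \<le> L * width v'"
      if "(v, v') \<in> parcs \<Gamma>" for v v'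
    proof -
      have *: "v \<in> vertices" "v' \<in> vertices" "\<bar>int (fst v) - int (fst v')\<bar> \<le> 1"
        "d (snd v) (snd v') \<le> exp (- real (fst v)) + exp (- real (fst v'))"
        using \<Gamma> that by (auto simp: filling_graph_def)
      show "v \<in> vertices" "v' \<in> vertices" by fact+
      show "\<rho> (snd v) (snd v') + width v' \<le> L * width v" by (rule L(2)[OF *])
      show "\<rho> (snd v) (snd v') + width v \<le> L * width v'"
        using L(2)[OF *(2,1)] *(3,4) Z.commute[of "snd v"] W.commute[of "snd v"] by simp
    qed
    have grad_le: "graph_gradient \<Gamma> ?F v \<le> (L + 1) * width v / s" if "v \<in> ?V" for v
    proof (rule graph_gradient_le[OF fin(2)])
      show "0 \<le> (L + 1) * width v / s"
        using L(1) s width_pos[of v] that V by auto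
      fix v' assume e: "(v, v') \<in> parcs \<Gamma>"
      have "\<bar>reach z v - reach z v'\<bar> \<le> \<rho> (snd v) (snd v') + width v + width v'"
        using W.triangle[of z "snd v" "snd v'"] W.triangle[of z "snd v'" "snd v"] z W.commute[of "snd v"]
          arc(1,2)[OF e] width_pos[of v] width_pos[of v'] by (simp add: reach_def)
      also have "\<dots> \<le> (L + 1) * width v"
        using arc(3)[OF e] by (simp add: algebra_simps)
      finally have "\<bar>reach z v / s - reach z v' / s\<bar> \<le> (L + 1) * width v / s"
        using s by (simp add: divide_right_mono flip: diff_divide_distrib)
      then show "\<bar>?F v - ?F v'\<bar> \<le> (L + 1) * width v / s"
        unfolding bump_def by linarith
    qed
    define A where "A = {v \<in> ?V. reach z v \<le> (2 + 2 * L) * s}"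
    have outside: "graph_gradient \<Gamma> ?F v = 0" if v: "v \<in> ?V - A" for v
    proof (rule antisym[OF graph_gradient_le[OF fin(2)] graph_gradient_nonneg[OF fin(2)]])
      have rv: "(2 + 2 * L) * s < reach z v"
        using v by (auto simp: A_def)
      moreover have "2 * s \<le> (2 + 2 * L) * s"
        using L(1) s by (intro mult_right_mono) auto
      ultimately have "2 * s \<le> reach z v" by linarith
      then have "?F v = 0"
        by (rule bump_eq_0[OF s])
      fix v' assume e: "(v, v') \<in> parcs \<Gamma>"
      have "2 * s \<le> reach z v'"
      \<comment> \<open>A neighbour \<open>v'\<close> of reach below \<open>2 * s\<close> has width
        below \<open>2 * s\<close>; the width comparison from the side of \<open>v'\<close> then
        gives \<open>v\<close> reach at most \<open>(2 + 2 * L) * s\<close>.\<close>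
      proof (rule ccontr)
        assume "\<not> ?thesis"
        then have r': "\<rho> z (snd v') + width v' < 2 * s" by (simp add: reach_def)
        then have "L * width v' \<le> L * (2 * s)"
          using W.nonneg[of z "snd v'"] L(1) by (intro mult_left_mono; linarith)
        moreover have "reach z v \<le> \<rho> z (snd v') + (\<rho> (snd v) (snd v') + width v)"
          using W.triangle[of z "snd v'" "snd v"] z W.commute[of "snd v"] arc(1,2)[OF e] by (simp add: reach_def)
        moreover have "\<rho> z (snd v') < 2 * s"
          using r' width_pos[OF arc(2)[OF e]] by linarith
        ultimately show False
          using rv arc(4)[OF e] by (simp add: algebra_simps)
      qed
      then show "\<bar>?F v - ?F v'\<bar> \<le> 0"
        using bump_eq_0[OF s] \<open>?F v = 0\<close> by simp
    qed simp
    have "(\<Sum>v\<in>?V. graph_gradient \<Gamma> ?F v powr p) = (\<Sum>v\<in>A. graph_gradient \<Gamma> ?F v powr p)"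
      using fin outside by (intro sum.mono_neutral_right) (auto simp: A_def)
    also have "\<dots> \<le> (\<Sum>v\<in>A. ((L + 1) / s) powr p * width v powr p)"
    proof (rule sum_mono)
      fix v assume v: "v \<in> A"
      then have "graph_gradient \<Gamma> ?F v powr p \<le> ((L + 1) / s * width v) powr p"
        using grad_le[of v] graph_gradient_nonneg[OF fin(2)] assms(2) by (intro powr_mono2) (auto simp: A_def)
      also have "\<dots> = ((L + 1) / s) powr p * width v powr p"
        by (rule powr_mult)
      finally show "graph_gradient \<Gamma> ?F v powr p \<le> ((L + 1) / s) powr p * width v powr p" .
    qed
    also have "\<dots> = ((L + 1) / s) powr p * (\<Sum>v\<in>A. width v powr p)"
      by (simp add: sum_distrib_left)
    also have "\<dots> \<le> ((L + 1) / s) powr p * (C * ((2 + 2 * L) * s) powr p)"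
    proof (intro mult_left_mono C(2)[OF _ _ z])
      show "\<rho> z (snd v) \<le> (2 + 2 * L) * s \<and> width v \<le> (2 + 2 * L) * s" if "v \<in> A" for v
      proof -
        have "v \<in> vertices" "reach z v \<le> (2 + 2 * L) * s"
          using that V by (auto simp: A_def)
        then show ?thesis
          using width_pos[of v] W.nonneg[of z "snd v"] unfolding reach_def by (intro conjI; linarith)
      qed
    qed (use fin V in \<open>auto simp: A_def\<close>)
    also have "\<dots> = ((L + 1) / s * ((2 + 2 * L) * s)) powr p * C"
      unfolding powr_mult[of "(L + 1) / s"] by (simp only: mult_ac)
    also have "(L + 1) / s * ((2 + 2 * L) * s) = (L + 1) * (2 + 2 * L)"
      using s by simp
    finally show "(\<Sum>v\<in>?V. graph_gradient \<Gamma> ?F v powr p) \<le> ((L + 1) * (2 + 2 * L)) powr p * C" .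
  qed
qed

text \<open>The bump found by \<open>concentration\<close> is fed into
  \<open>poincare_constant_le_bump\<close> with \<open>\<theta>\<close> equal to
  \<open>\<epsilon> * n\<close>; as the energy is bounded independently of \<open>n\<close>, the
  decay in \<open>n\<close> comes from the level sets alone.\<close>

lemma poincare_constant_filling:
  assumes p: "p > Q" "p \<ge> 1"
  obtains C M where "C > 0"
    "\<And>\<Gamma>. filling_graph \<Gamma> \<Longrightarrow> M \<le> real (card (pverts \<Gamma>)) \<Longrightarrow> 1 \<le> card (pverts \<Gamma>) \<Longrightarrow>
      poincare_constant p \<Gamma> \<le> C * real (card (pverts \<Gamma>)) powr (- 1 / p)"
proof -
  obtain E where E: "E > 0"
    "\<And>\<Gamma> z s. filling_graph \<Gamma> \<Longrightarrow> z \<in> S \<Longrightarrow> s > 0 \<Longrightarrow>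
      (\<Sum>v\<in>pverts \<Gamma>. graph_gradient \<Gamma> (bump z s) v powr p) \<le> E"
    using bump_energy[OF p] by blast
  obtain \<epsilon> M :: real where \<epsilon>: "0 < \<epsilon>" "\<epsilon> \<le> 1/2"
    "\<And>V. finite V \<Longrightarrow> V \<subseteq> vertices \<Longrightarrow> V \<noteq> {} \<Longrightarrow> M \<le> real (card V) \<Longrightarrow>
      \<exists>z\<in>S. \<exists>s>0. \<epsilon> * real (card V) \<le> real (card {v\<in>V. reach z v \<le> s}) \<and>
        1/2 * real (card V) \<le> real (card {v\<in>V. 2 * s < reach z v})"
    using concentration by blast
  show ?thesis
  proof (rule that[of "2 * (E / \<epsilon>) powr (1 / p)" M])
    show "2 * (E / \<epsilon>) powr (1 / p) > 0" using E(1) \<epsilon>(1) by simp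
    fix \<Gamma> assume \<Gamma>: "filling_graph \<Gamma>" "M \<le> real (card (pverts \<Gamma>))" "1 \<le> card (pverts \<Gamma>)"
    let ?V = "pverts \<Gamma>"
    define n where "n = real (card ?V)"
    have "n > 0" using \<Gamma>(3) by (simp add: n_def)
    have fin: "finite ?V" "finite (parcs \<Gamma>)" and V: "?V \<subseteq> vertices" "?V \<noteq> {}"
      using \<Gamma> by (auto simp: filling_graph_def)
    obtain z s where zs: "z \<in> S" "s > 0" "\<epsilon> * n \<le> real (card {v\<in>?V. reach z v \<le> s})"
        "1/2 * n \<le> real (card {v\<in>?V. 2 * s < reach z v})"
      using \<epsilon>(3)[OF fin(1) V \<Gamma>(2)] unfolding n_def by blast
    have "poincare_constant p \<Gamma> \<le> 2 * (E / (\<epsilon> * n)) powr (1 / p)"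
    proof (rule poincare_constant_le_bump[OF fin p(2)])
      show "0 < \<epsilon> * n" using \<epsilon>(1) \<open>n > 0\<close> by simp
      have "card {v\<in>?V. reach z v \<le> s} \<le> card {v \<in> ?V. bump z s v = 1}"
        using fin(1) bump_eq_1[OF zs(2)] by (intro card_mono) auto
      then show "\<epsilon> * n \<le> real (card {v \<in> ?V. bump z s v = 1})"
        using zs(3) by linarith
      have "card {v\<in>?V. 2 * s < reach z v} \<le> card {v \<in> ?V. bump z s v = 0}"
        using fin(1) bump_eq_0[OF zs(2)] by (intro card_mono) auto
      \<comment> \<open>One \<open>\<theta>\<close> must serve both level sets, whence the demand
        that \<open>\<epsilon>\<close> be at most 1/2.\<close>
      moreover have "\<epsilon> * n \<le> 1/2 * n"
        using \<epsilon>(2) \<open>n > 0\<close> by (intro mult_right_mono) auto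
      ultimately show "\<epsilon> * n \<le> real (card {v \<in> ?V. bump z s v = 0})"
        using zs(4) by linarith
      show "(\<Sum>v\<in>?V. graph_gradient \<Gamma> (bump z s) v powr p) \<le> E"
        by (rule E(2)[OF \<Gamma>(1) zs(1,2)])
    qed
    also have "E / (\<epsilon> * n) = (E / \<epsilon>) * (1 / n)"
      by simp
    also have "((E / \<epsilon>) * (1 / n)) powr (1 / p) = (E / \<epsilon>) powr (1 / p) * (1 / n) powr (1 / p)"
      by (rule powr_mult)
    also have "(1 / n) powr (1 / p) = n powr (- 1 / p)"
      using \<open>n > 0\<close> by (simp add: powr_divide powr_minus_divide)
    finally show "poincare_constant p \<Gamma> \<le> 2 * (E / \<epsilon>) powr (1 / p) * real (card ?V) powr (- 1 / p)"
      by (simp add: n_def)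
  qed
qed

end


section \<open>Compact Ahlfors regular spaces\<close>

lemma openin_mball_of: "openin (mtopology_of W) (mball_of W x r)"
proof -
  interpret Metric_space "mspace W" "mdist W" by simp
  show ?thesis
    unfolding mtopology_of_def mball_of_def by (rule openin_mball)
qed

lemma mdist_le_mdiam: "x \<in> mspace W \<Longrightarrow> y \<in> mspace W \<Longrightarrow> ennreal (mdist W x y) \<le> mdiam W"
  unfolding mdiam_def by (blast intro: SUP_upper2 order_refl)

text \<open>Compactness extends the upper bound to radii beyond the diameter.\<close>

lemma Ahlfors_regular_compactE:
  assumes compact: "compact_space (mtopology_of W)" and reg: "Ahlfors_regular Q W"
    and ab: "a \<in> mspace W" "b \<in> mspace W" "a \<noteq> b"
  obtains \<mu> C D where "0 < D" "\<And>x y. x \<in> mspace W \<Longrightarrow> y \<in> mspace W \<Longrightarrow> mdist W x y \<le> D" "0 < C"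
    "\<And>x r. mball_of W x r \<in> sets \<mu>"
    "\<And>x r. x \<in> mspace W \<Longrightarrow> 0 < r \<Longrightarrow> r < D \<Longrightarrow> ennreal (r powr Q / C) \<le> emeasure \<mu> (mball_of W x r)"
    "\<And>x r. x \<in> mspace W \<Longrightarrow> 0 < r \<Longrightarrow> emeasure \<mu> (mball_of W x r) \<le> ennreal (C * r powr Q)"
proof -
  interpret Metric_space "mspace W" "mdist W" by simp
  obtain \<mu> C where \<mu>: "space \<mu> = mspace W" "sets \<mu> = sigma_sets (mspace W) {U. openin (mtopology_of W) U}"
    and C: "C > 0" "\<And>x r. x \<in> mspace W \<Longrightarrow> r > 0 \<Longrightarrow> ennreal r < mdiam W \<Longrightarrow>
      ennreal (r powr Q / C) \<le> emeasure \<mu> (mball_of W x r) \<and> emeasure \<mu> (mball_of W x r) \<le> ennreal (C * r powr Q)"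
    using reg unfolding Ahlfors_regular_def by blast
  have ball_sets: "mball_of W x r \<in> sets \<mu>" for x r
    unfolding \<mu>(2) by (intro sigma_sets.Basic CollectI openin_mball_of)
  have "compactin mtopology (mspace W)"
    using compact by (simp add: compact_space_def mtopology_of_def)
  then obtain c B where cB: "mspace W \<subseteq> mcball c B"
    using compactin_imp_mbounded unfolding mbounded_def by blast
  have "mdist W x y \<le> 2 * B" if "x \<in> mspace W" "y \<in> mspace W" for x y
  proof -
    have "c \<in> mspace W" "mdist W c x \<le> B" "mdist W c y \<le> B"
      using cB that by auto
    then show ?thesis
      using triangle[of x c y] commute[of c x] that by linarith
  qed
  then have "mdiam W \<le> ennreal (2 * B)"
    unfolding mdiam_def by (intro SUP_least ennreal_leI) auto
  then have fin: "mdiam W \<noteq> top"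
    by (auto simp: top_unique)
  define D where "D = enn2real (mdiam W)"
  have D: "mdiam W = ennreal D" "0 \<le> D"
    using fin by (auto simp: D_def less_top)
  have dist_le: "mdist W x y \<le> D" if "x \<in> mspace W" "y \<in> mspace W" for x y
    using mdist_le_mdiam[OF that] D by (simp add: ennreal_le_iff)
  have "0 < D"
    using dist_le[OF ab(1,2)] mdist_pos_less[OF ab(3,1,2)] by linarith
  \<comment> \<open>Finitely many balls of radius \<open>D / 2\<close>, which is below the diameter,
    cover the space, so its total mass is at most \<open>M\<close>.\<close>
  have "mtotally_bounded (mspace W)"
    using compact compact_space_eq_mcomplete_mtotally_bounded by (simp add: mtopology_of_def)
  then obtain P where P: "finite P" "P \<subseteq> mspace W" "mspace W \<subseteq> (\<Union>x\<in>P. mball x (D / 2))"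
    unfolding mtotally_bounded_def using \<open>0 < D\<close> by (meson half_gt_zero)
  define M where "M = real (card P) * (C * (D / 2) powr Q)"
  have "0 \<le> M" using C(1) by (simp add: M_def)
  have "emeasure \<mu> (mspace W) \<le> emeasure \<mu> (\<Union>x\<in>P. mball_of W x (D / 2))"
    using P ball_sets by (intro emeasure_mono) (auto simp: mball_of_def)
  also have "\<dots> \<le> (\<Sum>x\<in>P. emeasure \<mu> (mball_of W x (D / 2)))"
    using P(1) ball_sets by (intro emeasure_subadditive_finite) auto
  also have "\<dots> \<le> (\<Sum>x\<in>P. ennreal (C * (D / 2) powr Q))"
    using C(2)[of _ "D / 2"] P(2) D \<open>0 < D\<close> by (intro sum_mono) (auto simp: ennreal_less_iff)
  also have "\<dots> = ennreal M"
    using C(1) by (simp add: M_def ennreal_mult ennreal_of_nat_eq_real_of_nat)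
  finally have total: "emeasure \<mu> (mspace W) \<le> ennreal M" .
  \<comment> \<open>The added term ensures \<open>M \<le> C' * D powr Q\<close>, so the total mass
    obeys the upper bound at every radius from \<open>D\<close> on; enlarging \<open>C\<close> only
    weakens the other bounds.\<close>
  define C' where "C' = C + M / D powr Q"
  have C': "C \<le> C'" "M \<le> C' * D powr Q"
    using \<open>0 \<le> M\<close> \<open>0 < D\<close> C(1) by (auto simp: C'_def distrib_right)
  have "0 \<le> Q" using reg by (simp add: Ahlfors_regular_def)
  show ?thesis
  proof (rule that[OF \<open>0 < D\<close> dist_le _ ball_sets, of C'])
    show "0 < C'" using C(1) C'(1) by simp
    fix x r assume x: "x \<in> mspace W" and r: "0 < (r::real)"
    show "ennreal (r powr Q / C') \<le> emeasure \<mu> (mball_of W x r)" if "r < D"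
    proof -
      have "ennreal (r powr Q / C') \<le> ennreal (r powr Q / C)"
        using C(1) C'(1) by (intro ennreal_leI divide_left_mono) auto
      also have "\<dots> \<le> emeasure \<mu> (mball_of W x r)"
        using C(2)[OF x r] that r D by (simp add: ennreal_less_iff)
      finally show ?thesis .
    qed
    show "emeasure \<mu> (mball_of W x r) \<le> ennreal (C' * r powr Q)"
    proof (cases "r < D")
      case True
      then have "emeasure \<mu> (mball_of W x r) \<le> ennreal (C * r powr Q)"
        using C(2)[OF x r] r D by (simp add: ennreal_less_iff)
      also have "\<dots> \<le> ennreal (C' * r powr Q)"
        using C'(1) by (intro ennreal_leI mult_right_mono) auto
      finally show ?thesis .
    next
      case False
      have "emeasure \<mu> (mball_of W x r) \<le> emeasure \<mu> (space \<mu>)"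
        by (rule emeasure_space)
      also have "\<dots> \<le> ennreal (C' * D powr Q)"
        using total C'(2) by (auto simp: \<mu>(1) intro: order_trans ennreal_leI)
      also have "\<dots> \<le> ennreal (C' * r powr Q)"
        using False \<open>0 < D\<close> \<open>0 \<le> Q\<close> C(1) C'(1) by (intro ennreal_leI mult_left_mono powr_mono2) auto
      finally show ?thesis .
    qed
  qed
qed

text \<open>Comparison of measures: the balls are disjoint, each has measure at least its radius to
  the power Q over C, and together they lie in a ball of measure at most
  \<open>C * R powr Q\<close>. Hence K is the square of C.\<close>

lemma Ahlfors_regular_packing:
  assumes "compact_space (mtopology_of W)" "Ahlfors_regular Q W"
    and "a \<in> mspace W" "b \<in> mspace W" "a \<noteq> b"
  obtains D K where "0 < D" "\<And>x y. x \<in> mspace W \<Longrightarrow> y \<in> mspace W \<Longrightarrow> mdist W x y \<le> D" "0 < K"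
    "\<And>(I :: 'i set) x r z R. finite I \<Longrightarrow> z \<in> mspace W \<Longrightarrow> 0 \<le> R \<Longrightarrow>
      (\<And>i. i \<in> I \<Longrightarrow> x i \<in> mspace W \<and> 0 < r i \<and> r i \<le> D / 2 \<and> mdist W z (x i) + r i \<le> R) \<Longrightarrow>
      pairwise (\<lambda>i j. mball_of W (x i) (r i) \<inter> mball_of W (x j) (r j) = {}) I \<Longrightarrow>
      (\<Sum>i\<in>I. r i powr Q) \<le> K * R powr Q"
proof -
  interpret Metric_space "mspace W" "mdist W" by simp
  obtain \<mu> C D where D: "0 < D" "\<And>x y. x \<in> mspace W \<Longrightarrow> y \<in> mspace W \<Longrightarrow> mdist W x y \<le> D"
    and C: "0 < C" and ball_sets: "\<And>x r. mball_of W x r \<in> sets \<mu>"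
    and lower: "\<And>x r. x \<in> mspace W \<Longrightarrow> 0 < r \<Longrightarrow> r < D \<Longrightarrow> ennreal (r powr Q / C) \<le> emeasure \<mu> (mball_of W x r)"
    and upper: "\<And>x r. x \<in> mspace W \<Longrightarrow> 0 < r \<Longrightarrow> emeasure \<mu> (mball_of W x r) \<le> ennreal (C * r powr Q)"
    by (rule Ahlfors_regular_compactE[OF assms]) blast
  show ?thesis
  proof (rule that[OF D, of "C * C"])
    show "0 < C * C" using C by simp
    fix I :: "'i set" and x r z R
    assume I: "finite I" "z \<in> mspace W" "0 \<le> R"
      "\<And>i. i \<in> I \<Longrightarrow> x i \<in> mspace W \<and> 0 < r i \<and> r i \<le> D / 2 \<and> mdist W z (x i) + r i \<le> R"
      "pairwise (\<lambda>i j. mball_of W (x i) (r i) \<inter> mball_of W (x j) (r j) = {}) I"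
    show "(\<Sum>i\<in>I. r i powr Q) \<le> C * C * R powr Q"
    proof (cases "I = {}")
      case True
      then show ?thesis using C by simp
    next
      case False
      then obtain i0 where "i0 \<in> I" by blast
      then have "0 < R"
        using I(4)[of i0] nonneg[of z "x i0"] by linarith
      have "ennreal ((\<Sum>i\<in>I. r i powr Q) / C) = (\<Sum>i\<in>I. ennreal (r i powr Q / C))"
        using C by (simp add: sum_divide_distrib sum_ennreal)
      also have "\<dots> \<le> (\<Sum>i\<in>I. emeasure \<mu> (mball_of W (x i) (r i)))"
      proof (intro sum_mono lower)
        show "r i < D" if "i \<in> I" for i
          using I(4)[OF that] D(1) by linarith
      qed (use I(4) in auto)
      also have "\<dots> = emeasure \<mu> (\<Union>i\<in>I. mball_of W (x i) (r i))"
        using I(1,5) ball_sets by (intro sum_emeasure) (auto simp: disjoint_family_on_def pairwise_def)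
      also have "\<dots> \<le> emeasure \<mu> (mball_of W z R)"
      proof (intro emeasure_mono ball_sets UN_least subsetI)
        fix i y assume i: "i \<in> I" "y \<in> mball_of W (x i) (r i)"
        then show "y \<in> mball_of W z R"
          using I(2) I(4)[OF i(1)] triangle[of z "x i" y] by auto
      qed
      also have "\<dots> \<le> ennreal (C * R powr Q)"
        by (rule upper[OF I(2) \<open>0 < R\<close>])
      finally have "(\<Sum>i\<in>I. r i powr Q) / C \<le> C * R powr Q"
        using C by (subst (asm) ennreal_le_iff) auto
      then show ?thesis
        using C by (simp add: field_simps)
    qed
  qed
qed

text \<open>If the annulus between radii \<open>\<tau> * q\<close> and \<open>q\<close> about
  \<open>x\<close> were empty, both balls would have the same measure, and the two measure bounds
  would force \<open>q powr Q / C\<close> below half of itself. Choosing such a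
  \<open>\<tau>\<close> is possible because \<open>Q\<close> is positive.\<close>

lemma Ahlfors_regular_uniformly_perfect:
  assumes "compact_space (mtopology_of W)" "Ahlfors_regular Q W"
    and "a \<in> mspace W" "b \<in> mspace W" "a \<noteq> b" and "0 < Q" "0 < B"
  obtains \<kappa> where "0 < \<kappa>"
    "\<And>x r. x \<in> mspace W \<Longrightarrow> 0 < r \<Longrightarrow> r \<le> B \<Longrightarrow> \<exists>y\<in>mspace W. \<kappa> * r \<le> mdist W x y \<and> mdist W x y \<le> r"
proof -
  interpret Metric_space "mspace W" "mdist W" by simp
  obtain \<mu> C D where D: "0 < D" "\<And>x y. x \<in> mspace W \<Longrightarrow> y \<in> mspace W \<Longrightarrow> mdist W x y \<le> D"
    and C: "0 < C" and ball_sets: "\<And>x r. mball_of W x r \<in> sets \<mu>"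
    and lower: "\<And>x r. x \<in> mspace W \<Longrightarrow> 0 < r \<Longrightarrow> r < D \<Longrightarrow> ennreal (r powr Q / C) \<le> emeasure \<mu> (mball_of W x r)"
    and upper: "\<And>x r. x \<in> mspace W \<Longrightarrow> 0 < r \<Longrightarrow> emeasure \<mu> (mball_of W x r) \<le> ennreal (C * r powr Q)"
    by (rule Ahlfors_regular_compactE[OF assms(1-5)]) blast
  define \<tau> where "\<tau> = (1 / (2 * C * C)) powr (1 / Q)"
  have \<tau>: "0 < \<tau>" "\<tau> powr Q = 1 / (2 * C * C)"
    using C \<open>0 < Q\<close> by (auto simp: \<tau>_def powr_powr)
  \<comment> \<open>Rescales radii up to \<open>B\<close> to at most \<open>D / 2\<close>, inside
    the range of the lower measure bound.\<close>
  define \<theta> where "\<theta> = min 1 (D / (2 * B))"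
  have \<theta>: "0 < \<theta>" "\<theta> \<le> 1" "\<theta> * B \<le> D / 2"
    using D(1) \<open>0 < B\<close> by (auto simp: \<theta>_def field_simps min_def)
  show ?thesis
  proof (rule that[of "\<tau> * \<theta>"])
    show "0 < \<tau> * \<theta>" using \<tau> \<theta> by simp
    fix x r assume x: "x \<in> mspace W" and r: "0 < r" "r \<le> B"
    define q where "q = \<theta> * r"
    have "\<theta> * r \<le> \<theta> * B" "\<theta> * r \<le> 1 * r"
      using \<theta> r by (auto intro: mult_left_mono mult_right_mono)
    then have q: "0 < q" "q < D" "q \<le> r"
      using mult_pos_pos[OF \<theta>(1) r(1)] \<theta>(3) D(1) unfolding q_def by linarith+
    have "\<exists>y\<in>mspace W. \<tau> * q \<le> mdist W x y \<and> mdist W x y < q"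
    proof (rule ccontr)
      assume none: "\<not> ?thesis"
      have "ennreal (q powr Q / C) \<le> emeasure \<mu> (mball_of W x q)"
        by (rule lower[OF x q(1,2)])
      also have "\<dots> \<le> emeasure \<mu> (mball_of W x (\<tau> * q))"
        using none ball_sets by (intro emeasure_mono) force+
      also have "\<dots> \<le> ennreal (C * (\<tau> * q) powr Q)"
        using q \<tau> by (intro upper x) auto
      finally have "q powr Q / C \<le> C * (\<tau> * q) powr Q"
        using C by (subst (asm) ennreal_le_iff) auto
      also have "\<dots> = q powr Q / C / 2"
        using C by (simp add: powr_mult \<tau>(2))
      finally show False
        using q C by (simp add: field_simps)
    qed
    then show "\<exists>y\<in>mspace W. \<tau> * \<theta> * r \<le> mdist W x y \<and> mdist W x y \<le> r"
      using q(3) by (force simp: q_def mult.assoc)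
  qed
qed

section \<open>Quasisymmetries\<close>

text \<open>Removing 0 leaves the half-line connected, removing any other point does not; a
  homeomorphism must therefore fix 0.\<close>

lemma homeomorphic_map_half_line_zero:
  fixes \<eta> :: "real \<Rightarrow> real"
  assumes "homeomorphic_map (top_of_set {0..}) (top_of_set {0..}) \<eta>"
  shows "\<eta> 0 = 0"
proof (rule ccontr)
  assume "\<eta> 0 \<noteq> 0"
  have im: "\<eta> ` {0..} = {0..}" and inj: "inj_on \<eta> {0..}"
    using homeomorphic_imp_surjective_map[OF assms] homeomorphic_imp_injective_map[OF assms] by auto
  have cont: "continuous_on {0..} \<eta>"
    using homeomorphic_imp_continuous_map[OF assms] by (simp add: continuous_map_in_subtopology)
  have "\<eta> 0 > 0"
    using im \<open>\<eta> 0 \<noteq> 0\<close> by (metis atLeast_iff imageI less_eq_real_def)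
  have "{0<..} = {0..} - {0 :: real}"
    by auto
  then have im': "\<eta> ` {0<..} = {0..} - {\<eta> 0}"
    using im inj by (simp add: inj_on_image_set_diff[OF inj])
  have "Topological_Spaces.connected (\<eta> ` {0<..})"
    using cont by (intro connected_continuous_image) (auto elim: continuous_on_subset)
  then have "is_interval ({0..} - {\<eta> 0})"
    unfolding im' by (simp add: is_interval_connected_1)
  then have "\<eta> 0 \<in> {0..} - {\<eta> 0}"
    using \<open>\<eta> 0 > 0\<close> mem_is_interval_1_I[of "{0..} - {\<eta> 0}" 0 "\<eta> 0 + 1" "\<eta> 0"] by simp
  then show False by simp
qed

text \<open>The first part uses that \<open>\<eta>\<close> is bounded on the compact interval from 0
  to \<open>a\<close>, the second that it is continuous with value 0 at 0. Without division the
  estimates also cover \<open>x = z\<close>, where the hypothesis forces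
  \<open>y = x\<close>.\<close>

lemma
  assumes "quasisymmetry Z W f"
  shows quasisymmetry_bounded:
      "\<exists>H\<ge>1. \<forall>x\<in>mspace Z. \<forall>y\<in>mspace Z. \<forall>z\<in>mspace Z.
         mdist Z x y \<le> a * mdist Z x z \<longrightarrow> mdist W (f x) (f y) \<le> H * mdist W (f x) (f z)"
    and quasisymmetry_small:
      "0 < \<epsilon> \<Longrightarrow> \<exists>l>0. \<forall>x\<in>mspace Z. \<forall>y\<in>mspace Z. \<forall>z\<in>mspace Z.
         mdist Z x y \<le> l * mdist Z x z \<longrightarrow> mdist W (f x) (f y) \<le> \<epsilon> * mdist W (f x) (f z)"
proof -
  interpret Z: Metric_space "mspace Z" "mdist Z" by simp
  interpret W: Metric_space "mspace W" "mdist W" by simp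
  obtain \<eta> :: "real \<Rightarrow> real" where \<eta>: "homeomorphic_map (top_of_set {0..}) (top_of_set {0..}) \<eta>"
    "\<And>x y z. x \<in> mspace Z \<Longrightarrow> y \<in> mspace Z \<Longrightarrow> z \<in> mspace Z \<Longrightarrow> x \<noteq> z \<Longrightarrow>
       mdist W (f x) (f y) / mdist W (f x) (f z) \<le> \<eta> (mdist Z x y / mdist Z x z)"
    and f: "homeomorphic_map (mtopology_of Z) (mtopology_of W) f"
    using assms unfolding quasisymmetry_def by blast
  have fW: "f x \<in> mspace W" if "x \<in> mspace Z" for x
    using homeomorphic_imp_surjective_map[OF f] that by auto
  have f_inj: "inj_on f (mspace Z)"
    using homeomorphic_imp_injective_map[OF f] by simp
  have cont: "continuous_on {0..} \<eta>"
    using homeomorphic_imp_continuous_map[OF \<eta>(1)] by (simp add: continuous_map_in_subtopology)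
  have transfer: "mdist W (f x) (f y) \<le> h * mdist W (f x) (f z)"
    if bound: "\<And>t. 0 \<le> t \<Longrightarrow> t \<le> a \<Longrightarrow> \<eta> t \<le> h"
      and xyz: "x \<in> mspace Z" "y \<in> mspace Z" "z \<in> mspace Z" "mdist Z x y \<le> a * mdist Z x z" for x y z a h
  proof (cases "x = z")
    case True
    then have "x = y"
      using xyz Z.nonneg[of x y] by (metis Z.mdist_zero Z.zero mult_zero_right order_antisym)
    then show ?thesis using True xyz fW by simp
  next
    case False
    then have "mdist Z x z > 0" "mdist W (f x) (f z) > 0"
      using xyz fW inj_onD[OF f_inj] by (metis Z.mdist_pos_eq, metis W.mdist_pos_eq)
    moreover from this have "\<eta> (mdist Z x y / mdist Z x z) \<le> h"
      using xyz(4) by (intro bound) (simp_all add: divide_le_eq)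
    then have "mdist W (f x) (f y) / mdist W (f x) (f z) \<le> h"
      using \<eta>(2)[OF xyz(1-3) False] by linarith
    ultimately show ?thesis by (simp add: divide_le_eq)
  qed
  show "\<exists>H\<ge>1. \<forall>x\<in>mspace Z. \<forall>y\<in>mspace Z. \<forall>z\<in>mspace Z.
         mdist Z x y \<le> a * mdist Z x z \<longrightarrow> mdist W (f x) (f y) \<le> H * mdist W (f x) (f z)" for a
  proof -
    have "compact (\<eta> ` {0..a})"
      using cont by (intro compact_continuous_image) (auto elim: continuous_on_subset)
    then obtain B where "\<And>t. t \<in> {0..a} \<Longrightarrow> \<bar>\<eta> t\<bar> \<le> B"
      using compact_imp_bounded by (force simp: bounded_iff)
    then have "\<eta> t \<le> max 1 B" if "0 \<le> t" "t \<le> a" for t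
      using that by (force simp: abs_le_iff)
    then show ?thesis
      using transfer[of a "max 1 B"] by (intro exI[of _ "max 1 B"]) simp
  qed
  show "\<exists>l>0. \<forall>x\<in>mspace Z. \<forall>y\<in>mspace Z. \<forall>z\<in>mspace Z.
         mdist Z x y \<le> l * mdist Z x z \<longrightarrow> mdist W (f x) (f y) \<le> \<epsilon> * mdist W (f x) (f z)" if \<epsilon>: "0 < \<epsilon>" for \<epsilon>
  proof -
    obtain l where l: "l > 0" "\<And>t. 0 \<le> t \<Longrightarrow> t < l \<Longrightarrow> \<eta> t < \<epsilon>"
    proof -
      have "\<exists>l>0. \<forall>t\<in>{0..}. dist t 0 < l \<longrightarrow> dist (\<eta> t) (\<eta> 0) < \<epsilon>"
        using cont \<epsilon> unfolding continuous_on_iff by (meson atLeast_iff order_refl)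
      then show ?thesis
        using that homeomorphic_map_half_line_zero[OF \<eta>(1)] by (force simp: dist_real_def abs_less_iff)
    qed
    have "\<eta> t \<le> \<epsilon>" if "0 \<le> t" "t \<le> l / 2" for t
      using l(2)[of t] l(1) that by simp
    then show ?thesis
      using transfer[of "l / 2" \<epsilon>] l(1) by (intro exI[of _ "l / 2"]) simp
  qed
qed

lemma quasisymmetric_refl: "quasisymmetric Z Z"
  unfolding quasisymmetric_def quasisymmetry_def
  by (intro exI[of _ id] conjI) auto

lemma conformal_dimension_le: "Ahlfors_regular Q Z \<Longrightarrow> conformal_dimension Z \<le> ereal Q"
  unfolding conformal_dimension_def using quasisymmetric_refl by (intro Inf_lower) auto

section \<open>Profiles of hyperbolic cones\<close>

text \<open>Instantiates the filling with \<open>d\<close> the rescaled metric of \<open>Z\<close>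
  and \<open>\<rho>\<close> the metric of \<open>W\<close> pulled back along \<open>f\<close>.
  Uniform perfectness comes from the regularity of \<open>Z\<close>, packing from that of
  \<open>W\<close>, and finite subgraphs of the cone are filling graphs.\<close>

lemma coarsely_le_hyperbolic_cone:
  assumes Z: "compact_space (mtopology_of Z)" "Ahlfors_regular Q\<^sub>Z Z" "0 < Q\<^sub>Z"
    and W: "quasisymmetric Z W" "Ahlfors_regular Q W"
    and X: "hyperbolic_cone Z X" and p: "Q < p" "1 \<le> p"
  shows "coarsely_le (poincare_profile X p) (\<lambda>r. r powr (1 - 1 / p))"
proof -
  obtain c N where c: "c > 0" "mdiam (mscale c Z) = ennreal (1/2)"
    and N: "\<And>t. maximal_separated_net (mscale c Z) (exp (- real t)) (N t)"
    and X_eq: "X = cone_graph (mscale c Z) N"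
    using X unfolding hyperbolic_cone_def by blast
  have "\<exists>a\<in>mspace Z. \<exists>b\<in>mspace Z. a \<noteq> b"
  proof (rule ccontr)
    assume "\<not> ?thesis"
    then have "mdist (mscale c Z) x y = 0" if "x \<in> mspace Z" "y \<in> mspace Z" for x y
      using that c(1) by (metis Metric_space.mdist_zero Metric_space_mspace_mdist mscale_simps(1))
    then have "mdiam (mscale c Z) \<le> 0"
      unfolding mdiam_def using c(1) by (intro SUP_least) simp
    then show False using c(2) by simp
  qed
  then obtain a b where ab: "a \<in> mspace Z" "b \<in> mspace Z" "a \<noteq> b" by blast
  obtain f where f: "quasisymmetry Z W f"
    using W(1) by (auto simp: quasisymmetric_def)
  have hom: "homeomorphic_map (mtopology_of Z) (mtopology_of W) f"
    using f by (simp add: quasisymmetry_def)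
  have f_im: "f ` mspace Z = mspace W" and f_inj: "inj_on f (mspace Z)"
    using homeomorphic_imp_surjective_map[OF hom] homeomorphic_imp_injective_map[OF hom] by auto
  have W_compact: "compact_space (mtopology_of W)"
    using Z(1) homeomorphic_compact_space[OF homeomorphic_map_imp_homeomorphic_space[OF hom]] by simp
  have fab: "f a \<in> mspace W" "f b \<in> mspace W" "f a \<noteq> f b"
    using ab f_im f_inj by (auto dest: inj_onD)
  \<comment> \<open>Radii up to \<open>1 / c\<close> in \<open>Z\<close> are radii up to 1 after
    rescaling.\<close>
  obtain \<kappa> where \<kappa>: "0 < \<kappa>"
    "\<And>x r. x \<in> mspace Z \<Longrightarrow> 0 < r \<Longrightarrow> r \<le> 1 / c \<Longrightarrow> \<exists>y\<in>mspace Z. \<kappa> * r \<le> mdist Z x y \<and> mdist Z x y \<le> r"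
    using Ahlfors_regular_uniformly_perfect[OF Z(1,2) ab Z(3), of "1 / c"] c(1) by auto
  obtain D K where D: "0 < D" "\<And>x y. x \<in> mspace W \<Longrightarrow> y \<in> mspace W \<Longrightarrow> mdist W x y \<le> D" and K: "0 < K"
    and pack: "\<And>(I :: (nat \<times> 'a) set) x r z R. finite I \<Longrightarrow> z \<in> mspace W \<Longrightarrow> 0 \<le> R \<Longrightarrow>
      (\<And>i. i \<in> I \<Longrightarrow> x i \<in> mspace W \<and> 0 < r i \<and> r i \<le> D / 2 \<and> mdist W z (x i) + r i \<le> R) \<Longrightarrow>
      pairwise (\<lambda>i j. mball_of W (x i) (r i) \<inter> mball_of W (x j) (r j) = {}) I \<Longrightarrow>
      (\<Sum>i\<in>I. r i powr Q) \<le> K * R powr Q"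
    by (rule Ahlfors_regular_packing[OF W_compact W(2) fab]) blast
  let ?d = "\<lambda>x y. c * mdist Z x y" and ?\<rho> = "\<lambda>x y. mdist W (f x) (f y)"
  interpret W: Metric_space "mspace W" "mdist W" by simp
  have "Metric_space (mspace Z) ?\<rho>"
  proof
    show "0 \<le> ?\<rho> x y" "?\<rho> x y = ?\<rho> y x" for x y
      by (simp_all add: W.commute)
    show "?\<rho> x y = 0 \<longleftrightarrow> x = y" if "x \<in> mspace Z" "y \<in> mspace Z" for x y
    proof -
      have "f x \<in> mspace W" "f y \<in> mspace W"
        using that f_im by auto
      then show ?thesis
        using that f_inj by (simp add: inj_on_eq_iff)
    qed
    show "?\<rho> x z \<le> ?\<rho> x y + ?\<rho> y z" if "x \<in> mspace Z" "y \<in> mspace Z" "z \<in> mspace Z" for x y z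
      using that f_im by (intro W.triangle) auto
  qed
  moreover have "Metric_space (mspace Z) ?d"
    by (rule Metric_space_scale[OF c(1)])
  ultimately interpret F: hyperbolic_filling "mspace Z" ?d ?\<rho> \<kappa> Q D K N
  proof (intro hyperbolic_filling.intro hyperbolic_filling_axioms.intro)
    show "0 < \<kappa>" "0 < D" "0 < K" by fact+
    show "0 \<le> Q" using W(2) by (simp add: Ahlfors_regular_def)
    show "\<exists>y\<in>mspace Z. \<kappa> * r \<le> ?d x y \<and> ?d x y \<le> r" if "x \<in> mspace Z" "0 < r" "r \<le> 1" for x r
      using \<kappa>(2)[of x "r / c"] that c(1) by (auto simp: field_simps)
    show "\<exists>H\<ge>1. \<forall>x\<in>mspace Z. \<forall>y\<in>mspace Z. \<forall>z\<in>mspace Z. ?d x y \<le> a * ?d x z \<longrightarrow> ?\<rho> x y \<le> H * ?\<rho> x z" for a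
      using quasisymmetry_bounded[OF f, of a] c(1) by (simp add: mult.left_commute[of a c])
    show "\<exists>l>0. \<forall>x\<in>mspace Z. \<forall>y\<in>mspace Z. \<forall>z\<in>mspace Z. ?d x y \<le> l * ?d x z \<longrightarrow> ?\<rho> x y \<le> \<epsilon> * ?\<rho> x z"
      if "0 < \<epsilon>" for \<epsilon>
      using quasisymmetry_small[OF f that] c(1) by (simp add: mult.left_commute[of _ c])
    show "?\<rho> x y \<le> D" if "x \<in> mspace Z" "y \<in> mspace Z" for x y
      using that f_im by (intro D(2)) auto
    show "N t \<subseteq> mspace Z" "x \<in> N t \<Longrightarrow> y \<in> N t \<Longrightarrow> x \<noteq> y \<Longrightarrow> exp (- real t) \<le> ?d x y" for t x y
      using N[of t] c(1) by (auto simp: maximal_separated_net_def separated_in_def)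
  next
    fix I :: "(nat \<times> 'a) set" and r z R
    assume I: "finite I" "z \<in> mspace Z" "0 \<le> R"
      "\<And>v. v \<in> I \<Longrightarrow> snd v \<in> mspace Z \<and> 0 < r v \<and> r v \<le> D / 2 \<and> ?\<rho> z (snd v) + r v \<le> R"
      "pairwise (\<lambda>v v'. Metric_space.mball (mspace Z) ?\<rho> (snd v) (r v) \<inter>
        Metric_space.mball (mspace Z) ?\<rho> (snd v') (r v') = {}) I"
    \<comment> \<open>\<open>f\<close> carries \<open>\<rho>\<close>-balls onto balls of
      \<open>W\<close>, and injectivity then transports disjointness.\<close>
    have ball: "mball_of W (f x) s = f ` Metric_space.mball (mspace Z) ?\<rho> x s" if "x \<in> mspace Z" for x s
    proof -
      have "Metric_space.mball (mspace Z) ?\<rho> x s = {y \<in> mspace Z. ?\<rho> x y < s}"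
        using that by (auto simp: Metric_space.in_mball[OF \<open>Metric_space (mspace Z) ?\<rho>\<close>])
      moreover have "mball_of W (f x) s = {u \<in> f ` mspace Z. mdist W (f x) u < s}"
        using that by (auto simp: f_im[symmetric])
      ultimately show ?thesis by auto
    qed
    show "(\<Sum>v\<in>I. r v powr Q) \<le> K * R powr Q"
    proof (rule pack[of I "f z" R "\<lambda>v. f (snd v)" r])
      show "pairwise (\<lambda>v v'. mball_of W (f (snd v)) (r v) \<inter> mball_of W (f (snd v')) (r v') = {}) I"
        unfolding pairwise_def
      proof (intro ballI impI)
        fix v v' assume v: "v \<in> I" "v' \<in> I" "v \<noteq> v'"
        then have "f ` (Metric_space.mball (mspace Z) ?\<rho> (snd v) (r v) \<inter>
            Metric_space.mball (mspace Z) ?\<rho> (snd v') (r v')) = {}"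
          using I(5) by (simp add: pairwise_def)
        then show "mball_of W (f (snd v)) (r v) \<inter> mball_of W (f (snd v')) (r v') = {}"
          using I(4) v by (simp add: ball inj_on_image_Int[OF f_inj]
              Metric_space.mball_subset_mspace[OF \<open>Metric_space (mspace Z) ?\<rho>\<close>])
      qed
    qed (use I f_im in auto)
  qed
  obtain C M where C: "C > 0"
    "\<And>\<Gamma>. F.filling_graph \<Gamma> \<Longrightarrow> M \<le> real (card (pverts \<Gamma>)) \<Longrightarrow> 1 \<le> card (pverts \<Gamma>) \<Longrightarrow>
      poincare_constant p \<Gamma> \<le> C * real (card (pverts \<Gamma>)) powr (- 1 / p)"
    using F.poincare_constant_filling[OF p] by blast
  show ?thesis
  proof (rule coarsely_le_poincare_profile[OF p(2) C(1) C(2)])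
    fix \<Gamma> assume \<Gamma>: "pair_graph \<Gamma>" "subgraph (with_proj \<Gamma>) (with_proj X)"
    interpret pair_graph \<Gamma> by fact
    have sub: "pverts \<Gamma> \<subseteq> pverts X" "parcs \<Gamma> \<subseteq> parcs X"
      using \<Gamma>(2) by (auto simp: subgraph_def)
    show "F.filling_graph \<Gamma>"
      unfolding F.filling_graph_def
    proof (intro conjI ballI)
      show "pverts \<Gamma> \<subseteq> F.vertices"
        using sub(1) by (simp add: X_eq cone_graph_def F.vertices_def)
      fix e assume "e \<in> parcs \<Gamma>"
      then have "e \<in> parcs X" using sub(2) by blast
      then obtain t x u y \<xi> where e: "e = ((t, x), (u, y))" "x \<in> N t" "y \<in> N u" "\<bar>int t - int u\<bar> \<le> 1"
          "\<xi> \<in> mball_of (mscale c Z) x (exp (- real t))" "\<xi> \<in> mball_of (mscale c Z) y (exp (- real u))"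
        unfolding X_eq cone_graph_def pair_pre_digraph.simps by blast
      then have "?d x y \<le> exp (- real t) + exp (- real u)"
        using c(1) F.Z.triangle[of x \<xi> y] F.Z.commute[of y \<xi>] by simp
      then show "case e of (v, v') \<Rightarrow> v \<in> F.vertices \<and> v' \<in> F.vertices \<and> \<bar>int (fst v) - int (fst v')\<bar> \<le> 1 \<and>
          ?d (snd v) (snd v') \<le> exp (- real (fst v)) + exp (- real (fst v'))"
        using e by (simp add: F.vertices_def)
    qed auto
  qed
qed

theorem theorem5p16:
  fixes Z :: "'a metric" and X :: "(nat \<times> 'a) pair_pre_digraph" and Q :: real
  assumes "compact_space (mtopology_of Z)"
    and "\<exists>Q'. Ahlfors_regular Q' Z"
    and "conformal_dimension Z = ereal Q" and "Q \<ge> 1"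
    and "hyperbolic_cone Z X"
  shows "ereal Q \<ge> Inf {ereal p | p. p \<ge> 1 \<and> coarsely_le (poincare_profile X p) (\<lambda>r. r powr (1 - 1 / p))}"
proof (rule ccontr)
  let ?I = "Inf {ereal p | p. p \<ge> 1 \<and> coarsely_le (poincare_profile X p) (\<lambda>r. r powr (1 - 1 / p))}"
  assume "\<not> ?thesis"
  \<comment> \<open>An exponent strictly between \<open>Q\<close> and the infimum; it will turn out
    to belong to the set, which is absurd.\<close>
  then obtain p where p: "ereal Q < ereal p" "ereal p < ?I"
    using ereal_dense2[of "ereal Q" ?I] by (auto simp: not_le)
  obtain Q\<^sub>Z where Q\<^sub>Z: "Ahlfors_regular Q\<^sub>Z Z"
    using assms(2) by blast
  \<comment> \<open>As \<open>Z\<close> is quasisymmetric to itself, its own exponent is at least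
    its conformal dimension, hence at least 1.\<close>
  then have "0 < Q\<^sub>Z"
    using conformal_dimension_le[OF Q\<^sub>Z] assms(3,4) by simp
  obtain Q' and W :: "'a metric" where "quasisymmetric Z W" "Ahlfors_regular Q' W" "Q' < p"
    using p(1) unfolding assms(3)[symmetric] conformal_dimension_def Inf_less_iff by auto
  then have "coarsely_le (poincare_profile X p) (\<lambda>r. r powr (1 - 1 / p))"
    using p(1) assms(4) by (intro coarsely_le_hyperbolic_cone[OF assms(1) Q\<^sub>Z \<open>0 < Q\<^sub>Z\<close> _ _ assms(5)]) auto
  then have "?I \<le> ereal p"
    using p(1) assms(4) by (intro Inf_lower) auto
  then show False
    using p(2) by simp
qed

end
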